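(* Let $\beta_1,\beta_2:\mathbb{CP}^1\to\mathbb{CP}^1$ be Belyi functions (in the sense of the context) such that $\beta_1^{-1}([-1,1])=\beta_2^{-1}([-1,1])$ as subsets of $\mathbb{CP}^1$, and such that $\mathbb{C}(\beta_1,\beta_2)=\mathbb{C}(z)$, i.e. $\beta_1$ and $\beta_2$ generate the whole field of rational functions $\mathbb{C}(z)$. Then either both dessins $\mathcal D_{\beta_1}$ and $\mathcal D_{\beta_2}$ are segments, or both $\mathcal D_{\beta_1}$ and $\mathcal D_{\beta_2}$ are circles.
   Context: A Belyi function is a non-constant rational function $\beta:\mathbb{CP}^1\to\mathbb{CP}^1$ ramified only over the points $-1,1,\infty$ (i.e. all its critical values lie in $\{-1,1,\infty\}$). The dessin $\mathcal D_\beta$ corresponding to $\beta$ is the set $\beta^{-1}([-1,1])\subset\mathbb{CP}^1$ considered as a bi-colored graph on the Riemann sphere whose white vertices are the points of $\beta^{-1}(\{-1\})$ and whose black vertices are the points of $\beta^{-1}(\{1\})$. The set $\beta^{-1}([-1,1])$ itself (without graph structure) is called the support of $\mathcal D_\beta$. A dessin is called a segment if its support is homeomorphic to a closed segment, and a circle if its support is homeomorphic to a circle. *)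

theory Defs
  imports "HOL-Analysis.Analysis" "HOL-Computational_Algebra.Computational_Algebra"
    "HOL-Computational_Algebra.Normalized_Fraction" "HOL-Computational_Algebra.Field_as_Ring"
begin

text \<open>A rational function is an element of the field C(z) = complex poly fract.
 The Riemann sphere CP^1 is modelled as complex option, None being the point at infinity.
 Its topology is the one induced by the inverse stereographic projection into R^3.\<close>

type_synonym ratfun = "complex poly fract"

definition num :: "ratfun \<Rightarrow> complex poly" where
  "num f = fst (quot_of_fract f)"

definition den :: "ratfun \<Rightarrow> complex poly" where
  "den f = snd (quot_of_fract f)"

definition zvar :: ratfun where "zvar = Fract [:0, 1:] 1"
definition cst :: "complex \<Rightarrow> ratfun" where "cst c = Fract [:c:] 1"

definition nonconstant :: "ratfun \<Rightarrow> bool" where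
  "nonconstant f \<longleftrightarrow> (\<forall>c. f \<noteq> cst c)"

text \<open>The induced map CP^1 -> CP^1 (numerator/denominator are coprime).\<close>
definition rat_eval :: "ratfun \<Rightarrow> complex option \<Rightarrow> complex option" where
  "rat_eval f x = (let p = num f; q = den f in
     case x of
       Some a \<Rightarrow> (if poly q a = 0 then None else Some (poly p a / poly q a))
     | None \<Rightarrow> (if degree p > degree q then None
                else Some (coeff p (degree q) / lead_coeff q)))"

definition ram_index :: "ratfun \<Rightarrow> complex option \<Rightarrow> nat" where
  "ram_index f x = (let p = num f; q = den f in
     case x of
       Some a \<Rightarrow> (if poly q a = 0 then order a q
                  else order a (p - smult (poly p a / poly q a) q))
     | None \<Rightarrow> (if degree p > degree q then degree p - degree q
                else max (degree p) (degree q)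
                     - degree (p - smult (coeff p (degree q) / lead_coeff q) q)))"

definition critical_point :: "ratfun \<Rightarrow> complex option \<Rightarrow> bool" where
  "critical_point f x \<longleftrightarrow> ram_index f x \<ge> 2"

definition critical_values :: "ratfun \<Rightarrow> complex option set" where
  "critical_values f = rat_eval f ` {x. critical_point f x}"

definition belyi :: "ratfun \<Rightarrow> bool" where
  "belyi f \<longleftrightarrow> nonconstant f \<and>
     critical_values f \<subseteq> {Some (-1), Some 1, None}"

definition dessin_support :: "ratfun \<Rightarrow> complex option set" where
  "dessin_support f = {x. \<exists>t::real. -1 \<le> t \<and> t \<le> 1 \<and> rat_eval f x = Some (complex_of_real t)}"

text \<open>Inverse stereographic projection CP^1 -> unit sphere in R^3.\<close>
definition sphere_embed :: "complex option \<Rightarrow> real \<times> real \<times> real" where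
  "sphere_embed x = (case x of
      None \<Rightarrow> (0, 0, 1)
    | Some z \<Rightarrow> (2 * Re z / ((cmod z)\<^sup>2 + 1), 2 * Im z / ((cmod z)\<^sup>2 + 1),
                ((cmod z)\<^sup>2 - 1) / ((cmod z)\<^sup>2 + 1)))"

definition is_segment :: "complex option set \<Rightarrow> bool" where
  "is_segment S \<longleftrightarrow> (sphere_embed ` S) homeomorphic {0..1::real}"

definition is_circle :: "complex option set \<Rightarrow> bool" where
  "is_circle S \<longleftrightarrow> (sphere_embed ` S) homeomorphic sphere (0::complex) 1"

inductive_set gen_field :: "ratfun \<Rightarrow> ratfun \<Rightarrow> ratfun set" for f g where
  cst: "cst c \<in> gen_field f g"
| left: "f \<in> gen_field f g"
| right: "g \<in> gen_field f g"
| add: "x \<in> gen_field f g \<Longrightarrow> y \<in> gen_field f g \<Longrightarrow> x + y \<in> gen_field f g"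
| mult: "x \<in> gen_field f g \<Longrightarrow> y \<in> gen_field f g \<Longrightarrow> x * y \<in> gen_field f g"
| inv: "x \<in> gen_field f g \<Longrightarrow> inverse x \<in> gen_field f g"

end

theory Submission
  imports Defs "HOL-Complex_Analysis.Complex_Analysis"
begin

text \<open>At a vertex of valency \<open>k \<ge> 3\<close>, both functions are real on \<open>k\<close> equiangular arcs, so
  Schwarz reflection makes them, and hence every element of \<open>\<complex>(\<beta>1, \<beta>2)\<close>, invariant under a
  nontrivial local rotation. This is impossible for \<open>z\<close>, so \<open>\<beta>1\<close> is ramified with index at
  most two over \<open>\<plusminus>1\<close>. Then the quadratic differential \<open>d\<beta>\<^sup>2 / (\<beta>\<^sup>2 - 1)\<close>, \<open>\<beta> = \<beta>1\<close>, has no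
  zeros; as its degree is \<open>-4\<close> and poles of \<open>\<beta>\<close> are double poles of it, \<open>\<beta>\<close> has one or two
  poles. After moving one of them to infinity, \<open>F w = \<beta> (m + d * cos w)\<close> (one pole) or
  \<open>F w = \<beta> (a + exp w)\<close> (two poles) satisfies \<open>F'\<^sup>2 = k (F\<^sup>2 - 1)\<close>, so \<open>F\<close> is \<open>cosh (s w + b)\<close>
  and the support is the image of a segment or of a circle, respectively.\<close>

section \<open>Orders of Wronskians\<close>

text \<open>Complex polynomials split into linear factors: a root of \<open>A\<close> is also a root
  of \<open>B\<close>, so a common linear factor can be removed from both and the degree of
  \<open>A\<close> drops.\<close>

lemma dvd_if_order_le:
  fixes A B :: "complex poly"
  assumes "A \<noteq> 0" and "B \<noteq> 0" and "\<And>x. order x A \<le> order x B"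
  shows "A dvd B"
  using assms
proof (induction "degree A" arbitrary: A B)
  case 0
  then show ?case by (metis is_unit_iff_degree unit_imp_dvd)
next
  case (Suc d)
  have "\<not> constant (poly A)"
    using Suc.hyps(2) by (simp add: constant_degree)
  then obtain a where a: "poly A a = 0"
    using Fundamental_Theorem_Algebra.fundamental_theorem_of_algebra by blast
  then have "order a A \<noteq> 0" using Suc.prems order_root by blast
  then have "order a B \<noteq> 0" using Suc.prems(3)[of a] by linarith
  then have "poly B a = 0" using order_root by blast
  then obtain B' where B: "B = [:-a, 1:] * B'" by (metis dvdE poly_eq_0_iff_dvd)
  obtain A' where A: "A = [:-a, 1:] * A'" using a by (metis dvdE poly_eq_0_iff_dvd)
  have "A' \<noteq> 0" "B' \<noteq> 0" using A B Suc.prems by auto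
  have "degree A = Suc (degree A')"
    unfolding A using \<open>A' \<noteq> 0\<close> by (subst degree_mult_eq) auto
  then have "d = degree A'" using Suc.hyps(2) by simp
  moreover have "order x A' \<le> order x B'" for x
    using Suc.prems(3)[of x] order_mult[OF Suc.prems(1)[unfolded A], of x]
      order_mult[OF Suc.prems(2)[unfolded B], of x]
    by (simp only: A B)
  ultimately have "A' dvd B'"
    using Suc.hyps(1)[of A' B'] \<open>A' \<noteq> 0\<close> \<open>B' \<noteq> 0\<close> by blast
  then show ?case unfolding A B by (rule mult_dvd_mono[OF dvd_refl])
qed

text \<open>With \<open>A = [:-x, 1:] ^ Suc k * s\<close>, the Wronskian is
  \<open>[:-x, 1:] ^ k * U\<close>, and \<open>U\<close> takes the value
  \<open>Suc k * s(x) * B(x)\<close> at \<open>x\<close>, which is nonzero in characteristic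
  zero.\<close>

lemma order_wronskian:
  fixes A B :: "complex poly"
  assumes "A \<noteq> 0" and "poly A x = 0" and "poly B x \<noteq> 0"
  shows "Suc (order x (pderiv A * B - A * pderiv B)) = order x A"
proof -
  obtain k where k: "order x A = Suc k"
    using assms order_root[of A x] not0_implies_Suc by blast
  obtain s where s: "A = [:-x, 1:] ^ Suc k * s" "\<not> [:-x, 1:] dvd s"
    using order_decomp[OF assms(1), of x] unfolding k by blast
  then have sx: "poly s x \<noteq> 0" by (simp add: poly_eq_0_iff_dvd)
  define U where "U = (smult (of_nat (Suc k)) s + [:-x, 1:] * pderiv s) * B - [:-x, 1:] * s * pderiv B"
  have "pderiv [:-x, 1:] = 1" by (simp add: pderiv_pCons)
  then have "pderiv A = [:-x, 1:] ^ k * (smult (of_nat (Suc k)) s + [:-x, 1:] * pderiv s)"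
    unfolding s(1) pderiv_mult pderiv_power_Suc by (simp add: algebra_simps del: of_nat_Suc)
  then have W: "pderiv A * B - A * pderiv B = [:-x, 1:] ^ k * U"
    unfolding U_def s(1) by (simp only: power_Suc) (simp only: algebra_simps)
  have "poly U x \<noteq> 0"
    using sx assms(3) by (simp add: U_def del: of_nat_Suc)
  then have "order x U = 0" "U \<noteq> 0" by (auto intro: order_0I)
  then have "order x ([:-x, 1:] ^ k * U) = k"
    by (subst order_mult) (auto simp: order_power_n_n)
  then show ?thesis by (simp add: W k)
qed

text \<open>The factor on the right is nonzero because the degrees differ, so this bounds the degree
  of the Wronskian from below.\<close>

lemma coeff_wronskian:
  fixes P Q :: "complex poly"
  assumes "degree Q < degree P"
  shows "coeff (pderiv P * Q - P * pderiv Q) (degree P + degree Q - 1) =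
    (of_nat (degree P) - of_nat (degree Q)) * (lead_coeff P * lead_coeff Q)"
proof -
  have lP: "coeff (pderiv P) (degree P - 1) = of_nat (degree P) * lead_coeff P"
    using assms by (simp add: coeff_pderiv)
  have "coeff (pderiv P * Q) (degree (pderiv P) + degree Q) = of_nat (degree P) * lead_coeff P * lead_coeff Q"
    by (subst coeff_mult_degree_sum) (simp add: degree_pderiv lP[unfolded One_nat_def])
  then have 1: "coeff (pderiv P * Q) (degree P + degree Q - 1) = of_nat (degree P) * lead_coeff P * lead_coeff Q"
    using assms by (simp add: degree_pderiv)
  have 2: "coeff (P * pderiv Q) (degree P + degree Q - 1) = of_nat (degree Q) * lead_coeff P * lead_coeff Q"
  \<comment> \<open>For constant \<open>Q\<close> the truncated \<open>degree Q - 1\<close> would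
    name the wrong coefficient.\<close>
  proof (cases "degree Q = 0")
    case True
    then have "pderiv Q = 0" by (simp add: pderiv_eq_0_iff)
    then show ?thesis using True by simp
  next
    case False
    then have lQ: "coeff (pderiv Q) (degree Q - 1) = of_nat (degree Q) * lead_coeff Q"
      by (simp add: coeff_pderiv)
    have "coeff (P * pderiv Q) (degree P + degree (pderiv Q)) = lead_coeff P * (of_nat (degree Q) * lead_coeff Q)"
      by (subst coeff_mult_degree_sum) (simp add: degree_pderiv lQ[unfolded One_nat_def])
    then show ?thesis using False by (simp add: degree_pderiv)
  qed
  show ?thesis unfolding coeff_diff 1 2 by (simp add: algebra_simps)
qed

section \<open>Maps with simple folds over \<open>\<plusminus>1\<close>\<close>

text \<open>The map is \<open>P / Q\<close>. By \<open>deg\<close>, infinity is a pole; by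
  \<open>ram\<close>, finite points over \<plusminus>1 are at most simple folds and points over
  other finite values are unramified. The orders of the poles stay free.\<close>

locale folded_map =
  fixes P Q :: "complex poly"
  assumes nz: "Q \<noteq> 0"
    and cop: "\<And>x. poly P x = 0 \<Longrightarrow> poly Q x \<noteq> 0"
    and deg: "degree Q < degree P"
    and ram: "\<And>x c. poly Q x \<noteq> 0 \<Longrightarrow> poly P x = c * poly Q x \<Longrightarrow>
                order x (P - smult c Q) \<le> (if c\<^sup>2 = 1 then 2 else 1)"
begin

text \<open>The derivative of \<open>P / Q\<close> is \<open>W / Q\<^sup>2\<close>, so the quadratic
  differential of the idea is
  \<open>W\<^sup>2 / (Q\<^sup>2 * (P\<^sup>2 - Q\<^sup>2))\<close>.\<close>

definition W where "W = pderiv P * Q - P * pderiv Q"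

lemma diff_nz: "P - smult c Q \<noteq> 0"
proof
  assume "P - smult c Q = 0"
  then have "degree P \<le> degree Q" by (metis degree_smult_le eq_iff_diff_eq_0)
  then show False using deg by simp
qed

lemma degree_W: "W \<noteq> 0" "degree P + degree Q - 1 \<le> degree W"
proof -
  have "coeff W (degree P + degree Q - 1) \<noteq> 0"
    unfolding W_def coeff_wronskian[OF deg] using deg nz by (auto simp flip: of_nat_diff)
  then show "W \<noteq> 0" "degree P + degree Q - 1 \<le> degree W" by (auto intro: le_degree)
qed

lemma squares_factor: "P\<^sup>2 - Q\<^sup>2 = (P - smult 1 Q) * (P - smult (-1) Q)"
  by (simp add: power2_eq_square algebra_simps)

lemma squares_nz: "P\<^sup>2 - Q\<^sup>2 \<noteq> 0"
  unfolding squares_factor using diff_nz no_zero_divisors by blast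

lemma degree_squares: "degree (P\<^sup>2 - Q\<^sup>2) = 2 * degree P"
proof -
  have "P \<noteq> 0" using deg by auto
  then have 2: "degree (P\<^sup>2) = 2 * degree P" "degree (Q\<^sup>2) = 2 * degree Q"
    using nz by (simp_all add: degree_power_eq)
  have "degree (P\<^sup>2 + - (Q\<^sup>2)) = degree (P\<^sup>2)"
    using deg by (intro degree_add_eq_left) (simp add: 2)
  then show ?thesis by (simp add: 2)
qed

text \<open>Exchanging \<open>P\<close> and \<open>Q\<close> only changes the sign of
  \<open>W\<close>.\<close>

lemma order_W_pole:
  assumes "poly Q x = 0"
  shows "Suc (order x W) = order x Q"
proof -
  have "order x W = order x (pderiv Q * P - Q * pderiv P)"
    using order_uminus[of x W] by (simp add: W_def algebra_simps)
  then show ?thesis using order_wronskian[of Q x P] assms cop nz by auto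
qed

text \<open>Replacing \<open>P\<close> by \<open>P - smult c Q\<close> does not change
  \<open>W\<close>.\<close>

lemma order_W_finite:
  assumes "poly Q x \<noteq> 0" and "poly P x = c * poly Q x"
  shows "Suc (order x W) = order x (P - smult c Q)"
proof -
  have "W = pderiv (P - smult c Q) * Q - (P - smult c Q) * pderiv Q"
    by (simp add: W_def pderiv_diff pderiv_smult algebra_simps)
  then show ?thesis using order_wronskian[of "P - smult c Q" x Q] assms diff_nz by simp
qed

text \<open>Over \<plusminus>1 exactly one factor of \<open>P\<^sup>2 - Q\<^sup>2\<close> vanishes,
  to order \<open>e\<close> equal to 1 or 2, and \<open>W\<close> has order \<open>e - 1\<close>;
  elsewhere both orders are 0. So away from the poles of \<open>P / Q\<close> the differential has
  no zeros, and its own poles are simple.\<close>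

lemma order_W_le:
  assumes "poly Q x \<noteq> 0"
  shows "2 * order x W \<le> order x (P\<^sup>2 - Q\<^sup>2)" "order x (P\<^sup>2 - Q\<^sup>2) \<le> 2 * order x W + 1"
proof -
  define c where "c = poly P x / poly Q x"
  have c: "poly P x = c * poly Q x" using assms by (simp add: c_def)
  note W = order_W_finite[OF assms c] and r = ram[OF assms c]
  have sum: "order x (P\<^sup>2 - Q\<^sup>2) = order x (P - smult 1 Q) + order x (P - smult (-1) Q)"
    using squares_nz unfolding squares_factor by (rule order_mult)
  have 0: "order x (P - smult d Q) = 0" if "d \<noteq> c" for d
    using that c assms by (intro order_0I) (simp flip: left_diff_distrib)
  consider "c = 1" | "c = -1" | "c\<^sup>2 \<noteq> 1" by (metis power2_eq_1_iff)
  then have "2 * order x W \<le> order x (P\<^sup>2 - Q\<^sup>2) \<and> order x (P\<^sup>2 - Q\<^sup>2) \<le> 2 * order x W + 1"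
  proof cases
    case 1
    then show ?thesis using W r 0[of "-1"] sum by auto
  next
    case 2
    then show ?thesis using W r 0[of "1"] sum by auto
  next
    case 3
    then have "c \<noteq> 1" "c \<noteq> -1" by auto
    then show ?thesis using W r 0[of "1"] 0[of "-1"] sum 3 by auto
  qed
  then show "2 * order x W \<le> order x (P\<^sup>2 - Q\<^sup>2)" "order x (P\<^sup>2 - Q\<^sup>2) \<le> 2 * order x W + 1" by auto
qed

text \<open>At a pole \<open>Q\<^sup>2\<close> exceeds \<open>W\<^sup>2\<close> by order two, which
  leaves room for a simple zero of \<open>R\<close>.\<close>

lemma W_dvd:
  assumes "R \<noteq> 0" and "\<And>x. order x R \<le> (if poly Q x = 0 then 1 else 0)"
  shows "(W * R)\<^sup>2 dvd Q\<^sup>2 * (P\<^sup>2 - Q\<^sup>2)"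
proof (rule dvd_if_order_le)
  show "(W * R)\<^sup>2 \<noteq> 0" using degree_W assms by simp
  show "Q\<^sup>2 * (P\<^sup>2 - Q\<^sup>2) \<noteq> 0" using nz squares_nz by simp
  fix x
  have "order x ((W * R)\<^sup>2) = 2 * order x W + 2 * order x R"
    using degree_W assms(1) by (simp add: power2_eq_square order_mult)
  moreover have "order x (Q\<^sup>2 * (P\<^sup>2 - Q\<^sup>2)) = 2 * order x Q + order x (P\<^sup>2 - Q\<^sup>2)"
  proof -
    have "order x (Q\<^sup>2 * (P\<^sup>2 - Q\<^sup>2)) = order x (Q\<^sup>2) + order x (P\<^sup>2 - Q\<^sup>2)"
      using nz squares_nz by (intro order_mult) simp
    also have "order x (Q\<^sup>2) = 2 * order x Q"
      using nz by (simp add: power2_eq_square order_mult)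
    finally show ?thesis .
  qed
  ultimately show "order x ((W * R)\<^sup>2) \<le> order x (Q\<^sup>2 * (P\<^sup>2 - Q\<^sup>2))"
    using assms(2)[of x] order_W_pole[of x] order_W_le(1)[of x] by (auto split: if_splits)
qed

text \<open>The left side has degree \<open>2 * (degree P + degree Q)\<close>, and \<open>W\<close>
  has degree at least \<open>degree P + degree Q - 1\<close>. This is the degree -4 of quadratic
  differentials, with the double pole at infinity already counted.\<close>

lemma degree_cofactor:
  assumes "Q\<^sup>2 * (P\<^sup>2 - Q\<^sup>2) = (W * R)\<^sup>2 * K"
  shows "2 * degree R + degree K \<le> 2"
proof -
  have nz0: "Q\<^sup>2 * (P\<^sup>2 - Q\<^sup>2) \<noteq> 0" using nz squares_nz by simp
  then have nz': "R \<noteq> 0" "K \<noteq> 0" unfolding assms by auto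
  have "degree (Q\<^sup>2 * (P\<^sup>2 - Q\<^sup>2)) = 2 * degree Q + 2 * degree P"
    using nz squares_nz by (subst degree_mult_eq) (auto simp: degree_squares degree_power_eq)
  moreover have "degree ((W * R)\<^sup>2 * K) = 2 * (degree W + degree R) + degree K"
    using nz' degree_W by (simp add: degree_mult_eq degree_power_eq)
  ultimately show ?thesis using assms degree_W(2) deg by simp
qed

text \<open>Two finite poles would allow an \<open>R\<close> of degree two, against the bound
  \<open>2 * degree R \<le> 2\<close>.\<close>

lemma at_most_one_pole:
  assumes "poly Q a = 0" and "poly Q b = 0"
  shows "a = b"
proof (rule ccontr)
  assume ab: "a \<noteq> b"
  define R where "R = [:-a, 1:] * [:-b, 1:]"
  have R0: "R \<noteq> 0" unfolding R_def by (metis mult_eq_0_iff pCons_eq_0_iff zero_neq_one)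
  have o: "order x [:-c, 1:] = (if x = c then 1 else 0)" for x c :: complex
    using order_power_n_n[of c 1] by (auto intro: order_0I)
  have "order x R \<le> (if poly Q x = 0 then 1 else 0)" for x
    using order_mult[OF R0[unfolded R_def], of x] ab assms unfolding R_def o by (auto split: if_splits)
  then obtain K where K: "Q\<^sup>2 * (P\<^sup>2 - Q\<^sup>2) = (W * R)\<^sup>2 * K"
    using W_dvd[OF R0] by (metis dvdE)
  have "degree R = 2" unfolding R_def by (subst degree_mult_eq) auto
  then show False using degree_cofactor[OF K] by simp
qed

text \<open>The linear factor at the pole uses up the whole degree bound, so the cofactor is
  constant.\<close>

lemma one_pole_identity:
  assumes "poly Q a = 0"
  obtains k where "k \<noteq> 0" and "Q\<^sup>2 * (P\<^sup>2 - Q\<^sup>2) = smult k ((W * [:-a, 1:])\<^sup>2)"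
proof -
  have o: "order x [:-a, 1:] = (if x = a then 1 else 0)" for x
    using order_power_n_n[of a 1] by (auto intro: order_0I)
  then have "(W * [:-a, 1:])\<^sup>2 dvd Q\<^sup>2 * (P\<^sup>2 - Q\<^sup>2)"
    using assms by (intro W_dvd) auto
  then obtain K where K: "Q\<^sup>2 * (P\<^sup>2 - Q\<^sup>2) = (W * [:-a, 1:])\<^sup>2 * K" ..
  then have "degree K = 0" using degree_cofactor[OF K] by simp
  then obtain k where k: "K = [:k:]" by (rule degree_eq_zeroE)
  have "Q\<^sup>2 * (P\<^sup>2 - Q\<^sup>2) \<noteq> 0" using nz squares_nz by simp
  then have "k \<noteq> 0" using K k by auto
  then show ?thesis using that K k by simp
qed

text \<open>Without finite poles \<open>Q\<close> is constant and \<open>W\<close> is a multiple of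
  \<open>pderiv P\<close>; comparing degrees shows that the cofactor \<open>K\<close> is quadratic.
  Its roots will be the ends of the segment.\<close>

lemma no_pole_identity:
  assumes "\<And>x. poly Q x \<noteq> 0"
  obtains q k u v where "Q = [:q:]" and "k \<noteq> 0" and "u \<noteq> v"
    and "P\<^sup>2 - [:q\<^sup>2:] = smult k ((pderiv P)\<^sup>2 * [:-u, 1:] * [:-v, 1:])"
proof -
  have "constant (poly Q)" using assms Fundamental_Theorem_Algebra.fundamental_theorem_of_algebra[of Q] by auto
  then have "degree Q = 0" by (simp add: constant_degree)
  then obtain q where q: "Q = [:q:]" by (rule degree_eq_zeroE)
  have q0: "q \<noteq> 0" using q nz by auto
  have WP: "W = smult q (pderiv P)" by (simp add: W_def) (simp add: q)
  have "(W * 1)\<^sup>2 dvd Q\<^sup>2 * (P\<^sup>2 - Q\<^sup>2)"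
    by (rule W_dvd) auto
  then obtain K where K: "Q\<^sup>2 * (P\<^sup>2 - Q\<^sup>2) = (W * 1)\<^sup>2 * K" ..
  have "smult (q\<^sup>2) (P\<^sup>2 - Q\<^sup>2) = smult (q\<^sup>2) ((pderiv P)\<^sup>2 * K)"
    using K unfolding WP by (simp add: q power2_eq_square mult.assoc)
  then have eq: "P\<^sup>2 - Q\<^sup>2 = (pderiv P)\<^sup>2 * K"
    using q0 by (metis power_not_zero smult_cancel)
  have P'0: "pderiv P \<noteq> 0" and K0: "K \<noteq> 0" using eq squares_nz by auto
  have "2 * degree P = 2 * (degree P - 1) + degree K"
    using arg_cong[OF eq, of degree] P'0 K0
    by (simp add: degree_squares degree_mult_eq degree_power_eq degree_pderiv)
  then have dK: "degree K = 2" using deg by simp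
  then have "\<not> constant (poly K)" by (simp add: constant_degree)
  then obtain u where "poly K u = 0" using Fundamental_Theorem_Algebra.fundamental_theorem_of_algebra by blast
  then obtain L where L: "K = [:-u, 1:] * L" by (metis dvdE poly_eq_0_iff_dvd)
  then have L0: "L \<noteq> 0" using K0 by auto
  have "degree L = 1" using dK L0 unfolding L by (subst (asm) degree_mult_eq) auto
  then have "\<not> constant (poly L)" by (simp add: constant_degree)
  then obtain v where "poly L v = 0" using Fundamental_Theorem_Algebra.fundamental_theorem_of_algebra by blast
  then obtain M where M: "L = [:-v, 1:] * M" by (metis dvdE poly_eq_0_iff_dvd)
  then have M0: "M \<noteq> 0" using L0 by auto
  have "degree M = 0" using \<open>degree L = 1\<close> M0 unfolding M by (subst (asm) degree_mult_eq) auto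
  then obtain k where k: "M = [:k:]" by (rule degree_eq_zeroE)
  have "k \<noteq> 0" using k M0 by auto
  have id: "P\<^sup>2 - [:q\<^sup>2:] = smult k ((pderiv P)\<^sup>2 * [:-u, 1:] * [:-v, 1:])"
  proof -
    have "K = smult k ([:-u, 1:] * [:-v, 1:])" unfolding L M k by (simp add: algebra_simps)
    moreover have "[:q\<^sup>2:] = Q\<^sup>2" by (simp add: q power2_eq_square)
    ultimately show ?thesis using eq by (simp only: mult_smult_right mult.assoc)
  qed
  \<comment> \<open>A double root of \<open>K\<close> would be a double pole of the differential
    away from the poles of \<open>P / Q\<close>.\<close>
  have "u \<noteq> v"
  proof
    assume "u = v"
    then have "[:-u, 1:]\<^sup>2 dvd K" unfolding L M power2_eq_square by (metis dvd_triv_left mult.assoc)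
    then have "2 \<le> order u K" using K0 order_divides by blast
    moreover have "order u (P\<^sup>2 - Q\<^sup>2) = 2 * order u W + order u K"
    proof -
      have "order u W = order u (pderiv P)" using q0 by (simp add: WP order_smult)
      moreover have "order u ((pderiv P)\<^sup>2 * K) = order u ((pderiv P)\<^sup>2) + order u K"
        using P'0 K0 by (intro order_mult) simp
      moreover have "order u ((pderiv P)\<^sup>2) = 2 * order u (pderiv P)"
        using P'0 by (simp add: power2_eq_square order_mult)
      ultimately show ?thesis by (simp add: eq)
    qed
    ultimately show False using order_W_le(2)[of u] assms by simp
  qed
  then show ?thesis using that q \<open>k \<noteq> 0\<close> id by blast
qed

end

section \<open>The equation \<open>F'\<^sup>2 = k (F\<^sup>2 - 1)\<close>\<close>

text \<open>\<open>cosh z\<close> is the cosine of \<open>\<i> * z\<close>, and the complex cosine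
  takes values in [-1,1] exactly at real arguments.\<close>

lemma cosh_in_interval_iff:
  fixes z :: complex
  shows "(\<exists>t::real. -1 \<le> t \<and> t \<le> 1 \<and> cosh z = of_real t) \<longleftrightarrow> Re z = 0"
proof
  assume "\<exists>t::real. -1 \<le> t \<and> t \<le> 1 \<and> cosh z = of_real t"
  then obtain t :: real where t: "-1 \<le> t" "t \<le> 1" "cosh z = of_real t" by blast
  then have "cos (\<i> * z) = cos (of_real (arccos t))"
    by (simp add: cos_of_real cosh_conv_cos)
  then obtain n where "n \<in> \<int>"
    "\<i> * z = of_real (arccos t) + of_real (2 * n * pi) \<or> \<i> * z = - of_real (arccos t) + of_real (2 * n * pi)"
    unfolding complex_cos_eq by blast
  then have "\<i> * z = of_real (arccos t + 2 * n * pi) \<or> \<i> * z = of_real (- arccos t + 2 * n * pi)"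
    by simp
  then have "Im (\<i> * z) = 0" by (metis Im_complex_of_real)
  then show "Re z = 0" by simp
next
  assume "Re z = 0"
  then have "z = \<i> * of_real (Im z)" by (simp add: complex_eq_iff)
  then have "cosh z = cos (\<i> * (\<i> * of_real (Im z)))" by (metis cosh_conv_cos)
  also have "\<dots> = of_real (cos (Im z))"
    using cos_minus[of "complex_of_real (Im z)"] by (simp add: cos_of_real flip: mult.assoc)
  finally show "\<exists>t::real. -1 \<le> t \<and> t \<le> 1 \<and> cosh z = of_real t"
    using cos_ge_minus_one cos_le_one by blast
qed

lemma exp_ode:
  fixes G :: "complex \<Rightarrow> complex"
  assumes "\<And>w. (G has_field_derivative s * G w) (at w)"
  shows "G w = G 0 * exp (s * w)"
proof -
  have "((\<lambda>w. G w * exp (- s * w)) has_field_derivative 0) (at w)" for w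
    by (rule derivative_eq_intros assms | simp)+
  then have "(\<lambda>w. G w * exp (- s * w)) constant_on UNIV"
    by (intro has_field_derivative_0_imp_constant_on) auto
  then obtain c where c: "G w * exp (- s * w) = c" for w
    unfolding constant_on_def by blast
  have "G w * exp (- s * w) = G 0" using c[of w] c[of 0] by simp
  then show ?thesis by (simp add: exp_minus field_simps)
qed

text \<open>Differentiation turns the equation into the linear one \<open>F'' = k F\<close>, which
  splits into two first-order equations solved by exponentials. The original equation at 0 then
  fixes the product of the two constants.\<close>

lemma cosh_ode:
  fixes F :: "complex \<Rightarrow> complex"
  assumes F': "\<And>w. (F has_field_derivative F' w) (at w)"
    and ode: "\<And>w. (F' w)\<^sup>2 = k * ((F w)\<^sup>2 - 1)"
    and "k \<noteq> 0" and nc: "\<not> F constant_on UNIV"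
  obtains s b where "s \<noteq> 0" and "\<And>w. F w = cosh (s * w + b)"
proof -
  have holF: "F holomorphic_on UNIV"
    using F' holomorphic_on_open open_UNIV by blast
  have dF: "deriv F = F'" using F' DERIV_imp_deriv by blast
  have holF': "F' holomorphic_on UNIV"
    unfolding dF[symmetric] by (rule holomorphic_deriv[OF holF]) auto
  have F'': "(F' has_field_derivative deriv F' w) (at w)" for w
    using holF' by (rule holomorphic_derivI) auto
  have eq: "F' w * (deriv F' w - k * F w) = 0" for w
  proof -
    have "((\<lambda>w. (F' w)\<^sup>2) has_field_derivative 2 * F' w * deriv F' w) (at w)"
      by (rule derivative_eq_intros F'' | simp)+
    moreover have "((\<lambda>w. (F' w)\<^sup>2) has_field_derivative k * (2 * F w * F' w)) (at w)"
      unfolding ode by (rule derivative_eq_intros F' | simp)+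
    ultimately have "2 * F' w * deriv F' w = k * (2 * F w * F' w)" by (rule DERIV_unique)
    then show ?thesis by (simp add: algebra_simps)
  qed
  obtain x where x: "F' x \<noteq> 0"
  proof -
    have "F constant_on UNIV" if "\<And>w. F' w = 0"
    proof (rule has_field_derivative_0_imp_constant_on)
      show "(F has_field_derivative 0) (at w)" for w using F'[of w] that by simp
    qed auto
    then show ?thesis using that nc by blast
  qed
  define N where "N = {w. F' w \<noteq> 0}"
  have "open N"
  proof -
    have "continuous_on UNIV F'" using holF' by (rule holomorphic_on_imp_continuous_on)
    then show ?thesis unfolding N_def by (intro open_Collect_neq) auto
  qed
  \<comment> \<open>Cancelling \<open>F'\<close> is legitimate on the nonempty open set
    \<open>N\<close>; the identity theorem carries the result to the whole plane.\<close>
  have "deriv F' w = k * F w" for w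
  proof (rule analytic_continuation_open[of N UNIV "deriv F'" "\<lambda>w. k * F w"])
    show "N \<noteq> {}" using x by (auto simp: N_def)
    show "deriv F' holomorphic_on UNIV" using holF' by (rule holomorphic_deriv) auto
    show "(\<lambda>w. k * F w) holomorphic_on UNIV" by (intro holomorphic_intros holF)
    show "deriv F' z = k * F z" if "z \<in> N" for z using eq[of z] that by (simp add: N_def)
  qed (use \<open>open N\<close> in auto)
  then have F'': "(F' has_field_derivative k * F w) (at w)" for w using F'' by simp
  define s where "s = csqrt k"
  have s: "s\<^sup>2 = k" "s \<noteq> 0" using \<open>k \<noteq> 0\<close> by (auto simp: s_def)
  have "((\<lambda>w. F' w + s * F w) has_field_derivative s * (F' w + s * F w)) (at w)" for w
    by (rule derivative_eq_intros F' F'' | simp add: s(1)[symmetric] power2_eq_square algebra_simps)+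
  note 1 = exp_ode[OF this]
  have "((\<lambda>w. F' w - s * F w) has_field_derivative (-s) * (F' w - s * F w)) (at w)" for w
    by (rule derivative_eq_intros F' F'' | simp add: s(1)[symmetric] power2_eq_square algebra_simps)+
  note 2 = exp_ode[OF this]
  \<comment> \<open>Since \<open>A * B = - s\<^sup>2\<close>, the numbers \<open>A / s\<close> and
    \<open>- B / s\<close> are inverse to each other, so a single \<open>b\<close> serves both
    exponentials.\<close>
  define A B where "A = F' 0 + s * F 0" and "B = F' 0 - s * F 0"
  have "A * B = (F' 0)\<^sup>2 - s\<^sup>2 * (F 0)\<^sup>2" by (simp add: A_def B_def power2_eq_square algebra_simps)
  also have "\<dots> = - s\<^sup>2" by (simp add: ode s algebra_simps)
  finally have AB: "A * B = - s\<^sup>2" .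
  then have A: "A \<noteq> 0" using s by auto
  define b where "b = Ln (A / s)"
  have b: "exp b = A / s" unfolding b_def using A s by (intro exp_Ln) auto
  have "exp (-b) = s / A" by (simp add: exp_minus b)
  also have "\<dots> = - B / s" using AB A s by (simp add: field_simps power2_eq_square)
  finally have b': "exp (-b) = - B / s" .
  have "F w = cosh (s * w + b)" for w
  proof -
    have "2 * s * F w = (F' w + s * F w) - (F' w - s * F w)" by simp
    also have "\<dots> = A * exp (s * w) - B * exp (- s * w)"
      unfolding 1[of w] 2[of w] A_def B_def ..
    finally have "2 * s * F w = A * exp (s * w) - B * exp (- s * w)" .
    also have "\<dots> = s * (exp (s * w) * exp b + exp (- s * w) * exp (- b))"
      unfolding b b' using s by (simp add: algebra_simps)
    also have "\<dots> = s * (2 * cosh (s * w + b))"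
      by (simp add: cosh_field_def flip: exp_add)
    finally have "2 * s * F w = 2 * s * cosh (s * w + b)" by simp
    then show ?thesis using s by simp
  qed
  then show ?thesis using that s by blast
qed

text \<open>Taking \<open>u = 0\<close> gives \<open>cosh c = 1\<close>, hence
  \<open>sinh c = 0\<close>, and \<open>exp c\<close> is their sum.\<close>

lemma cosh_period:
  fixes c :: complex
  assumes "\<And>u. cosh (u + c) = cosh u"
  shows "exp c = 1"
proof -
  have "cosh c = 1" using assms[of 0] by simp
  moreover from this have "sinh c = 0" using sinh_square_eq[of c] by simp
  ultimately show ?thesis using sinh_plus_cosh[of c] by simp
qed

text \<open>Taking \<open>u = b\<close> gives \<open>sinh b = 0\<close>, so
  \<open>exp b = cosh b\<close> is \<plusminus>1.\<close>

lemma cosh_even: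
  fixes b :: complex
  assumes "\<And>u. cosh (b + u) = cosh (b - u)"
  shows "Re b = 0"
proof -
  have "cosh (b + b) = cosh (b - b)" by (rule assms)
  then have "sinh b * sinh b = 0" unfolding cosh_add cosh_diff by simp
  then have "sinh b = 0" by simp
  then have "(cosh b)\<^sup>2 = 1" by (simp add: cosh_square_eq)
  moreover have "exp b = cosh b" using sinh_plus_cosh[of b] \<open>sinh b = 0\<close> by simp
  ultimately have "(exp (Re b))\<^sup>2 = 1" by (metis norm_exp_eq_Re norm_one norm_power)
  then have "exp (Re b) = 1" using power2_eq_1_iff[of "exp (Re b)"] exp_gt_zero[of "Re b"] by linarith
  then show ?thesis by simp
qed

section \<open>The shape of the support: segment or circle\<close>

context folded_map
begin

text \<open>Poles have to be excluded explicitly: division by zero yields 0, which lies in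
  [-1,1].\<close>

definition supp where
  "supp = {x. poly Q x \<noteq> 0 \<and> (\<exists>t::real. -1 \<le> t \<and> t \<le> 1 \<and> poly P x / poly Q x = of_real t)}"

lemma not_constant_on:
  assumes "infinite X" and "\<And>x. x \<in> X \<Longrightarrow> poly Q x \<noteq> 0"
  shows "\<exists>x\<in>X. poly P x / poly Q x \<noteq> c"
proof (rule ccontr)
  assume "\<not> ?thesis"
  then have "X \<subseteq> {x. poly (P - smult c Q) x = 0}" using assms(2) by (auto simp: field_simps)
  then show False using poly_roots_finite[OF diff_nz] assms(1) finite_subset by blast
qed

text \<open>In the coordinate \<open>x = m + d * cos w\<close> the identity without poles becomes
  the equation of \<open>cosh_ode\<close>. Periodicity and evenness of the cosine make
  \<open>s\<close> and \<open>b\<close> purely imaginary, so the support is the image of the real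
  line.\<close>

lemma supp_segment:
  assumes "\<And>x. poly Q x \<noteq> 0"
  obtains m d where "d \<noteq> 0" and "supp = (\<lambda>t::real. m + d * of_real t) ` {-1..1}"
proof -
  obtain q k u v where q: "Q = [:q:]" and k: "k \<noteq> 0" and uv: "u \<noteq> v"
    and id: "P\<^sup>2 - [:q\<^sup>2:] = smult k ((pderiv P)\<^sup>2 * [:-u, 1:] * [:-v, 1:])"
    using no_pole_identity[OF assms] by blast
  have q0: "q \<noteq> 0" using q nz by auto
  \<comment> \<open>Midpoint and half difference of the roots, chosen so that
    \<open>(x - u) * (x - v)\<close> becomes \<open>- (d\<^sup>2 * (sin w)\<^sup>2)\<close>.\<close>
  define m d where "m = (u + v) / 2" and "d = (u - v) / 2"
  have d0: "d \<noteq> 0" using uv by (simp add: d_def)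
  define F where "F = (\<lambda>w. poly P (m + d * cos w) / q)"
  define F' where "F' = (\<lambda>w. poly (pderiv P) (m + d * cos w) * (- d * sin w) / q)"
  have der: "(F has_field_derivative F' w) (at w)" for w
    unfolding F_def F'_def
    by (rule derivative_eq_intros poly_DERIV[THEN DERIV_chain2] q0 | simp)+
  have ode: "(F' w)\<^sup>2 = (- 1 / k) * ((F w)\<^sup>2 - 1)" for w
  proof -
    define x where "x = m + d * cos w"
    have "(x - u) * (x - v) = (x - m)\<^sup>2 - d\<^sup>2"
      by (simp add: m_def d_def power2_eq_square field_simps)
    also have "\<dots> = - (d\<^sup>2 * (sin w)\<^sup>2)"
      by (simp add: x_def power_mult_distrib sin_squared_eq algebra_simps)
    finally have 1: "(x - u) * (x - v) = - (d\<^sup>2 * (sin w)\<^sup>2)" .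
    have "(poly P x)\<^sup>2 - q\<^sup>2 = k * ((poly (pderiv P) x)\<^sup>2 * ((x - u) * (x - v)))"
    proof -
      have "poly [:-u, 1:] x = x - u" "poly [:-v, 1:] x = x - v" "poly [:q\<^sup>2:] x = q\<^sup>2" by simp_all
      then show ?thesis
        using arg_cong[OF id, of "\<lambda>p. poly p x"]
        unfolding poly_smult poly_mult poly_power poly_diff by (simp only: mult.assoc)
    qed
    then have "(poly P x)\<^sup>2 - q\<^sup>2 = - k * ((poly (pderiv P) x)\<^sup>2 * (d\<^sup>2 * (sin w)\<^sup>2))"
      unfolding 1 by simp
    note eq = this
    have "(F w)\<^sup>2 - 1 = ((poly P x)\<^sup>2 - q\<^sup>2) / q\<^sup>2"
      using q0 by (simp add: F_def power_divide diff_divide_distrib flip: x_def)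
    also have "\<dots> = - k * (F' w)\<^sup>2"
      unfolding eq by (simp add: F'_def power_divide power_mult_distrib flip: x_def)
    finally have "(F w)\<^sup>2 - 1 = - k * (F' w)\<^sup>2" .
    then show ?thesis using k by simp
  qed
  have surj: "\<exists>w. x = m + d * cos w" for x
    by (rule exI[of _ "Arccos ((x - m) / d)"]) (simp add: d0)
  have "\<not> F constant_on UNIV"
  proof
    assume "F constant_on UNIV"
    then obtain c where "F w = c" for w unfolding constant_on_def by blast
    then have "poly P x / poly Q x = c" for x using surj[of x] by (auto simp: F_def q)
    then show False using not_constant_on[of UNIV c] assms infinite_UNIV_char_0 by blast
  qed
  then obtain s b where s: "s \<noteq> 0" and F: "\<And>w. F w = cosh (s * w + b)"
    using cosh_ode[OF der ode] k by auto
  have "cosh (y + s * (2 * pi)) = cosh y" for y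
  proof -
    have "cosh (s * ((y - b) / s + 2 * pi) + b) = cosh (s * ((y - b) / s) + b)"
      unfolding F[symmetric] by (simp add: F_def cos_add flip: cos_of_real sin_of_real)
    then show ?thesis using s by (simp add: algebra_simps)
  qed
  then have "exp (s * (2 * pi)) = 1" by (rule cosh_period)
  then have Re_s: "Re s = 0" by (simp add: exp_eq_1)
  then have Im_s: "Im s \<noteq> 0" using s by (simp add: complex_eq_iff)
  have "cosh (b + y) = cosh (b - y)" for y
  proof -
    have "F (y / s) = F (- (y / s))" by (simp add: F_def)
    then show ?thesis using s by (simp add: F algebra_simps)
  qed
  then have Re_b: "Re b = 0" by (rule cosh_even)
  have mem: "m + d * cos w \<in> supp \<longleftrightarrow> Im w = 0" for w
  proof -
    have "m + d * cos w \<in> supp \<longleftrightarrow> (\<exists>t::real. -1 \<le> t \<and> t \<le> 1 \<and> F w = of_real t)"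
      using q0 assms unfolding supp_def F_def by (simp add: q)
    also have "\<dots> \<longleftrightarrow> Im w = 0"
      unfolding F cosh_in_interval_iff using Re_s Im_s Re_b by simp
    finally show ?thesis .
  qed
  have "supp = (\<lambda>t::real. m + d * of_real t) ` {-1..1}"
  proof (intro equalityI subsetI)
    fix x assume "x \<in> supp"
    moreover obtain w where x: "x = m + d * cos w" using surj by blast
    ultimately have "Im w = 0" using mem by simp
    then have "w = of_real (Re w)" by (simp add: complex_eq_iff)
    then have "x = m + d * of_real (cos (Re w))" using x by (metis cos_of_real)
    then show "x \<in> (\<lambda>t::real. m + d * of_real t) ` {-1..1}" by auto
  next
    fix x assume "x \<in> (\<lambda>t::real. m + d * of_real t) ` {-1..1}"
    then obtain t :: real where t: "-1 \<le> t" "t \<le> 1" "x = m + d * of_real t" by auto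
    then have "x = m + d * cos (of_real (arccos t))" by (simp add: cos_of_real)
    then show "x \<in> supp" using mem[of "of_real (arccos t)"] by simp
  qed
  then show ?thesis using that d0 by blast
qed

text \<open>The coordinate \<open>x = a + exp w\<close> covers the plane without the pole and
  absorbs the factor \<open>[:-a, 1:]\<close>. The period of \<open>exp\<close> forces
  \<open>s\<close> to be real, so the support is the image of a vertical line.\<close>

lemma supp_circle:
  assumes "poly Q a = 0"
  obtains r where "r > 0" and "supp = sphere a r"
proof -
  obtain k where k: "k \<noteq> 0" and id: "Q\<^sup>2 * (P\<^sup>2 - Q\<^sup>2) = smult k ((W * [:-a, 1:])\<^sup>2)"
    using one_pole_identity[OF assms] by blast
  have Q0: "poly Q x \<noteq> 0" if "x \<noteq> a" for x using at_most_one_pole[of a x] assms that by blast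
  define F where "F = (\<lambda>w. poly P (a + exp w) / poly Q (a + exp w))"
  define F' where "F' = (\<lambda>w. poly W (a + exp w) * exp w / (poly Q (a + exp w))\<^sup>2)"
  have der: "(F has_field_derivative F' w) (at w)" for w
  proof -
    have "poly Q (a + exp w) \<noteq> 0" using Q0 by simp
    then show ?thesis
      unfolding F_def F'_def W_def
      by - (rule derivative_eq_intros poly_DERIV[THEN DERIV_chain2] | simp add: power2_eq_square algebra_simps)+
  qed
  have ode: "(F' w)\<^sup>2 = (1 / k) * ((F w)\<^sup>2 - 1)" for w
  proof -
    define x where "x = a + exp w"
    have Qx: "poly Q x \<noteq> 0" using Q0 by (simp add: x_def)
    have "(poly Q x)\<^sup>2 * ((poly P x)\<^sup>2 - (poly Q x)\<^sup>2) = k * (poly W x * exp w)\<^sup>2"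
    proof -
      have "poly [:-a, 1:] x = exp w" by (simp add: x_def)
      then show ?thesis
        using arg_cong[OF id, of "\<lambda>p. poly p x"]
        unfolding poly_smult poly_mult poly_power poly_diff by simp
    qed
    note eq = this
    have "(F w)\<^sup>2 - 1 = ((poly P x)\<^sup>2 - (poly Q x)\<^sup>2) / (poly Q x)\<^sup>2"
      using Qx by (simp add: F_def power_divide diff_divide_distrib flip: x_def)
    also have "\<dots> = (poly Q x)\<^sup>2 * ((poly P x)\<^sup>2 - (poly Q x)\<^sup>2) / ((poly Q x)\<^sup>2)\<^sup>2"
      using Qx by (simp add: power2_eq_square)
    also have "\<dots> = k * (F' w)\<^sup>2"
      unfolding eq by (simp add: F'_def power_divide flip: x_def)
    finally have "(F w)\<^sup>2 - 1 = k * (F' w)\<^sup>2" .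
    then show ?thesis using k by simp
  qed
  have surj: "\<exists>w. x = a + exp w" if "x \<noteq> a" for x
    by (rule exI[of _ "Ln (x - a)"]) (use that in simp)
  have "\<not> F constant_on UNIV"
  proof
    assume "F constant_on UNIV"
    then obtain c where "F w = c" for w unfolding constant_on_def by blast
    then have "poly P x / poly Q x = c" if "x \<in> - {a}" for x using surj[of x] that by (auto simp: F_def)
    moreover have "infinite (- {a})" by (simp add: infinite_UNIV_char_0 Compl_eq_Diff_UNIV)
    ultimately show False using not_constant_on[of "- {a}" c] Q0 by blast
  qed
  then obtain s b where s: "s \<noteq> 0" and F: "\<And>w. F w = cosh (s * w + b)"
    using cosh_ode[OF der ode] k by auto
  have "cosh (y + s * (2 * pi * \<i>)) = cosh y" for y
  proof -
    have "cosh (s * ((y - b) / s + 2 * pi * \<i>) + b) = cosh (s * ((y - b) / s) + b)"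
      unfolding F[symmetric] by (simp add: F_def exp_add)
    then show ?thesis using s by (simp add: algebra_simps)
  qed
  then have "exp (s * (2 * pi * \<i>)) = 1" by (rule cosh_period)
  then have Im_s: "Im s = 0" by (simp add: exp_eq_1)
  then have Re_s: "Re s \<noteq> 0" using s by (simp add: complex_eq_iff)
  \<comment> \<open>The modulus of \<open>exp w\<close> on the line
    \<open>Re s * Re w + Re b = 0\<close>.\<close>
  define r where "r = exp (- Re b / Re s)"
  have mem: "a + exp w \<in> supp \<longleftrightarrow> cmod (exp w) = r" for w
  proof -
    have "a + exp w \<in> supp \<longleftrightarrow> (\<exists>t::real. -1 \<le> t \<and> t \<le> 1 \<and> F w = of_real t)"
      using Q0 by (simp add: supp_def F_def)
    also have "\<dots> \<longleftrightarrow> Re s * Re w + Re b = 0"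
      unfolding F cosh_in_interval_iff using Im_s by simp
    also have "\<dots> \<longleftrightarrow> Re w = - Re b / Re s" using Re_s by (auto simp: field_simps)
    finally show ?thesis by (simp add: r_def)
  qed
  have "r > 0" by (simp add: r_def)
  have "x \<in> supp \<longleftrightarrow> x \<in> sphere a r" for x
  proof (cases "x = a")
    case True
    then show ?thesis using \<open>r > 0\<close> assms by (simp add: supp_def)
  next
    case False
    then obtain w where "x = a + exp w" using surj by blast
    then show ?thesis using mem[of w] by (simp add: dist_norm)
  qed
  then show ?thesis using that \<open>r > 0\<close> by blast
qed

end

section \<open>Vertices of high valency\<close>

text \<open>Schwarz reflection in the line through \<open>\<zeta>\<close>, which is the map taking
  \<open>x\<close> to \<open>\<zeta>\<^sup>2 * cnj x\<close>.\<close>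

lemma reflection:
  assumes H: "H holomorphic_on ball 0 \<rho>" and \<zeta>: "cmod \<zeta> = 1"
    and real: "\<And>t. 0 < t \<Longrightarrow> t < \<rho> \<Longrightarrow> H (\<zeta> * of_real t) \<in> \<real>"
    and x: "x \<in> ball 0 \<rho>"
  shows "H (\<zeta>\<^sup>2 * cnj x) = cnj (H x)"
proof -
  have \<rho>: "\<rho> > 0" using x by (simp add: le_less_trans[OF norm_ge_zero])
  have G: "(\<lambda>w. H (\<zeta> * w)) holomorphic_on ball 0 \<rho>"
    by (rule holomorphic_on_compose_gen[OF _ H, unfolded o_def])
      (auto intro!: holomorphic_intros simp: norm_mult \<zeta>)
  have "(\<lambda>w. H (\<zeta> * w)) holomorphic_on cnj ` ball 0 \<rho>"
    by (rule holomorphic_on_subset[OF G]) auto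
  then have "cnj \<circ> (\<lambda>w. H (\<zeta> * w)) \<circ> cnj holomorphic_on ball 0 \<rho>"
    by (rule holomorphic_on_compose_cnj_cnj) simp
  then have G': "(\<lambda>w. cnj (H (\<zeta> * cnj w))) holomorphic_on ball 0 \<rho>" by (simp add: o_def)
  \<comment> \<open>Both terms agree on a real interval accumulating at 0, hence on the whole
    ball.\<close>
  have eq: "H (\<zeta> * w) - cnj (H (\<zeta> * cnj w)) = 0" if "w \<in> ball 0 \<rho>" for w
  proof (rule analytic_continuation[where f = "\<lambda>w. H (\<zeta> * w) - cnj (H (\<zeta> * cnj w))" and S = "ball 0 \<rho>"
        and U = "complex_of_real ` {0<..<\<rho>}" and \<xi> = 0])
    show "(\<lambda>w. H (\<zeta> * w) - cnj (H (\<zeta> * cnj w))) holomorphic_on ball 0 \<rho>"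
      by (intro holomorphic_intros G G')
    show "0 islimpt complex_of_real ` {0<..<\<rho>}"
    proof (subst islimpt_approachable, intro allI impI)
      fix e :: real assume "e > 0"
      then show "\<exists>x'\<in>complex_of_real ` {0<..<\<rho>}. x' \<noteq> 0 \<and> dist x' 0 < e"
        using \<rho> by (auto simp: min_less_iff_disj intro!: bexI[of _ "min e \<rho> / 2"])
    qed
    show "H (\<zeta> * z) - cnj (H (\<zeta> * cnj z)) = 0" if "z \<in> complex_of_real ` {0<..<\<rho>}" for z
      using that real by (auto simp: Reals_cnj_iff)
  qed (use \<rho> that in auto)
  have \<zeta>\<zeta>: "\<zeta> * cnj \<zeta> = 1" using \<zeta> by (simp add: complex_norm_square[symmetric])
  have "\<zeta> * cnj x \<in> ball 0 \<rho>" using x \<zeta> by (simp add: norm_mult)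
  note eq[OF this]
  moreover have "\<zeta> * cnj (\<zeta> * cnj x) = x" using \<zeta>\<zeta> by (simp flip: mult.assoc)
  ultimately have "H (\<zeta> * (\<zeta> * cnj x)) = cnj (H x)" by (simp only: right_minus_eq)
  then show ?thesis by (simp add: power2_eq_square mult.assoc)
qed

text \<open>Reflecting in the real line and then in the line through \<open>\<zeta>\<close> is the
  rotation by \<open>\<zeta>\<^sup>2\<close>.\<close>

lemma rotation_invariant:
  assumes H: "H holomorphic_on ball 0 \<rho>" and \<zeta>: "cmod \<zeta> = 1"
    and 0: "\<And>t. 0 < t \<Longrightarrow> t < \<rho> \<Longrightarrow> H (of_real t) \<in> \<real>"
    and 1: "\<And>t. 0 < t \<Longrightarrow> t < \<rho> \<Longrightarrow> H (\<zeta> * of_real t) \<in> \<real>"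
    and x: "x \<in> ball 0 \<rho>"
  shows "H (\<zeta>\<^sup>2 * x) = H x"
  using reflection[OF H \<zeta> 1, of "cnj x"] reflection[OF H, of 1 "cnj x"] 0 x by simp

text \<open>Near \<open>y\<close> the function \<open>g\<close> has a holomorphic logarithm, hence a
  \<open>k\<close>-th root; \<open>\<phi>\<close> is the local inverse of \<open>z - y\<close> times
  that root, whose derivative at \<open>y\<close> is nonzero.\<close>

lemma local_power_chart:
  assumes g: "g holomorphic_on ball y r" and r: "r > 0" and gy: "g y \<noteq> 0" and k: "k > 0"
  obtains \<rho> \<phi> where "\<rho> > 0" and "\<phi> holomorphic_on ball 0 \<rho>" and "inj_on \<phi> (ball 0 \<rho>)"
    and "\<And>w. w \<in> ball 0 \<rho> \<Longrightarrow> \<phi> w \<in> ball y r"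
    and "\<And>w. w \<in> ball 0 \<rho> \<Longrightarrow> (\<phi> w - y) ^ k * g (\<phi> w) = w ^ k"
proof -
  have "continuous (at y) g"
    using g r continuous_on_interior holomorphic_on_imp_continuous_on by fastforce
  then obtain e where e: "e > 0" "\<And>z. dist y z < e \<Longrightarrow> g z \<noteq> 0"
    using continuous_at_avoid[of y g 0] gy by blast
  define r1 where "r1 = min r e"
  have r1: "r1 > 0" "ball y r1 \<subseteq> ball y r" using r e by (auto simp: r1_def)
  have g1: "g holomorphic_on ball y r1" using g r1(2) by (rule holomorphic_on_subset)
  have g0: "g z \<noteq> 0" if "z \<in> ball y r1" for z using e that by (simp add: r1_def)
  obtain l where l: "l holomorphic_on ball y r1" "\<And>z. z \<in> ball y r1 \<Longrightarrow> exp (l z) = g z"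
    using contractible_imp_holomorphic_log[OF g1] g0 convex_imp_contractible[OF convex_ball] by metis
  define v where "v = (\<lambda>z. (z - y) * exp (l z / of_nat k))"
  have v: "v holomorphic_on ball y r1"
    unfolding v_def using k by (intro holomorphic_intros l) auto
  have vk: "v z ^ k = (z - y) ^ k * g z" if "z \<in> ball y r1" for z
    using l(2)[OF that] k by (simp add: v_def power_mult_distrib flip: exp_of_nat_mult)
  have "(v has_field_derivative exp (l y / of_nat k)) (at y)"
  proof -
    have "(l has_field_derivative deriv l y) (at y)"
      using l(1) r1 by (intro holomorphic_derivI) auto
    then show ?thesis unfolding v_def using k by (auto intro!: derivative_eq_intros)
  qed
  then have "deriv v y \<noteq> 0" using DERIV_imp_deriv by force
  then obtain r2 where r2: "r2 > 0" "ball y r2 \<subseteq> ball y r1" "inj_on v (ball y r2)"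
    using has_complex_derivative_locally_injective[OF v, of y] r1 by auto
  have v2: "v holomorphic_on ball y r2" using v r2(2) by (rule holomorphic_on_subset)
  obtain \<phi> where \<phi>: "\<phi> holomorphic_on v ` ball y r2" "\<And>z. z \<in> ball y r2 \<Longrightarrow> \<phi> (v z) = z"
    using holomorphic_has_inverse[OF v2 _ r2(3)] by (metis open_ball)
  have "open (v ` ball y r2)" using v2 r2(3) by (intro open_mapping_thm3) auto
  moreover have "0 \<in> v ` ball y r2" using r2(1) by (auto simp: v_def image_iff intro!: bexI[of _ y])
  ultimately obtain \<rho> where \<rho>: "\<rho> > 0" "ball 0 \<rho> \<subseteq> v ` ball y r2" by (metis openE)
  have w: "\<phi> w \<in> ball y r2" "v (\<phi> w) = w" if "w \<in> ball 0 \<rho>" for w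
    using that \<rho>(2) \<phi>(2) by force+
  show ?thesis
  proof (rule that[OF \<rho>(1)])
    show "\<phi> holomorphic_on ball 0 \<rho>" using \<phi>(1) \<rho>(2) by (rule holomorphic_on_subset)
    show "inj_on \<phi> (ball 0 \<rho>)" using w(2) by (rule inj_on_inverseI)
    fix x :: complex assume x: "x \<in> ball 0 \<rho>"
    show "\<phi> x \<in> ball y r" using w(1)[OF x] r2(2) r1(2) by blast
    show "(\<phi> x - y) ^ k * g (\<phi> x) = x ^ k"
      using vk[of "\<phi> x"] w[OF x] r2(2) by auto
  qed
qed

section \<open>Pairs of points that the generated field cannot separate\<close>

lemma num_den:
  "coprime (num f) (den f)" "den f \<noteq> 0" "f = Fract (num f) (den f)"
proof -
  have "quot_of_fract f \<in> normalized_fracts" by simp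
  then show "coprime (num f) (den f)" "den f \<noteq> 0"
    by (auto simp: normalized_fracts_def num_def den_def)
  show "f = Fract (num f) (den f)"
    using quot_to_fract_quot_of_fract[of f] by (simp add: quot_to_fract_def num_def den_def case_prod_beta)
qed

lemma rat_eval_Some_D:
  assumes "rat_eval f (Some x) = Some c"
  shows "poly (den f) x \<noteq> 0" "poly (num f) x = c * poly (den f) x"
  using assms by (auto simp: rat_eval_def Let_def split: if_splits)

lemma rat_eval_agree:
  assumes "rat_eval f (Some x) = rat_eval f (Some y) \<and> rat_eval f (Some x) \<noteq> None"
  shows "poly (num f) x * poly (den f) y = poly (num f) y * poly (den f) x"
proof -
  obtain c where "rat_eval f (Some x) = Some c" "rat_eval f (Some y) = Some c"
    using assms by (metis option.exhaust)
  then show ?thesis by (simp add: rat_eval_Some_D(2))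
qed

text \<open>Induction over the field operations. The cross-multiplied form survives inversion; as
  \<open>p\<close> and \<open>q\<close> need not be coprime, it carries no information where
  \<open>q\<close> vanishes at both points and \<open>p\<close> does too.\<close>

lemma gen_field_agree:
  assumes "h \<in> gen_field f g"
    and f: "\<And>x y. (x, y) \<in> D \<Longrightarrow> rat_eval f (Some x) = rat_eval f (Some y) \<and> rat_eval f (Some x) \<noteq> None"
    and g: "\<And>x y. (x, y) \<in> D \<Longrightarrow> rat_eval g (Some x) = rat_eval g (Some y) \<and> rat_eval g (Some x) \<noteq> None"
  shows "\<exists>p q. q \<noteq> 0 \<and> h = Fract p q \<and> (\<forall>x y. (x, y) \<in> D \<longrightarrow> poly p x * poly q y = poly p y * poly q x)"
  using assms(1)
proof induction
  case (cst c)
  then show ?case by (intro exI[of _ "[:c:]"] exI[of _ 1]) (auto simp: cst_def)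
next
  case left
  then show ?case using num_den(2,3)[of f] rat_eval_agree[OF f]
    by (intro exI[of _ "num f"] exI[of _ "den f"]) blast
next
  case right
  then show ?case using num_den(2,3)[of g] rat_eval_agree[OF g]
    by (intro exI[of _ "num g"] exI[of _ "den g"]) blast
next
  case (add u v)
  then obtain p q p' q' where u: "q \<noteq> 0" "u = Fract p q" "\<forall>x y. (x, y) \<in> D \<longrightarrow> poly p x * poly q y = poly p y * poly q x"
    and v: "q' \<noteq> 0" "v = Fract p' q'" "\<forall>x y. (x, y) \<in> D \<longrightarrow> poly p' x * poly q' y = poly p' y * poly q' x" by blast
  have "poly (p * q' + p' * q) x * poly (q * q') y = poly (p * q' + p' * q) y * poly (q * q') x"
    if "(x, y) \<in> D" for x y
  proof -
    have "poly p x * poly q y = poly p y * poly q x" "poly p' x * poly q' y = poly p' y * poly q' x"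
      using u v that by auto
    then show ?thesis by (simp, algebra)
  qed
  then show ?case using u v
    by (intro exI[of _ "p * q' + p' * q"] exI[of _ "q * q'"]) (auto simp del: poly_mult poly_add)
next
  case (mult u v)
  then obtain p q p' q' where u: "q \<noteq> 0" "u = Fract p q" "\<forall>x y. (x, y) \<in> D \<longrightarrow> poly p x * poly q y = poly p y * poly q x"
    and v: "q' \<noteq> 0" "v = Fract p' q'" "\<forall>x y. (x, y) \<in> D \<longrightarrow> poly p' x * poly q' y = poly p' y * poly q' x" by blast
  have "poly (p * p') x * poly (q * q') y = poly (p * p') y * poly (q * q') x" if "(x, y) \<in> D" for x y
  proof -
    have "poly p x * poly q y = poly p y * poly q x" "poly p' x * poly q' y = poly p' y * poly q' x"
      using u v that by auto
    then show ?thesis by (simp, algebra)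
  qed
  then show ?case using u v
    by (intro exI[of _ "p * p'"] exI[of _ "q * q'"]) (auto simp del: poly_mult)
next
  case (inv u)
  then obtain p q where u: "q \<noteq> 0" "u = Fract p q" "\<forall>x y. (x, y) \<in> D \<longrightarrow> poly p x * poly q y = poly p y * poly q x"
    by blast
  show ?case
  proof (cases "p = 0")
    case True
    then show ?thesis using u
      by (intro exI[of _ 0] exI[of _ 1]) (simp add: fract_collapse)
  next
    case False
    moreover have "poly q x * poly p y = poly q y * poly p x" if "(x, y) \<in> D" for x y
      using u(3) that by (metis mult.commute)
    ultimately show ?thesis using u by - (rule exI[of _ q], rule exI[of _ p], auto)
  qed
qed

text \<open>The chart \<open>M\<close> need not be defined at \<open>y\<close> itself, which may correspond to infinity.
  In the coordinate \<open>w\<close> with \<open>\<beta>1 = \<epsilon> (1 - w ^ k)\<close> the support contains the rays \<open>w ^ k \<ge> 0\<close>;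
  reflection in two adjacent ones gives the rotation by \<open>4\<pi> / k\<close>, which is trivial only for
  \<open>k \<le> 2\<close>.\<close>

lemma ramification_at_vertex_le_2:
  assumes supp: "dessin_support \<beta>1 = dessin_support \<beta>2"
    and gen: "gen_field \<beta>1 \<beta>2 = UNIV"
    and r: "r > 0" and g: "g holomorphic_on ball y r" "g y \<noteq> 0" and B2: "B2 holomorphic_on ball y r"
    and M: "inj_on M (ball y r - {y})"
    and \<beta>1: "\<And>z. z \<in> ball y r - {y} \<Longrightarrow> rat_eval \<beta>1 (Some (M z)) = Some (\<epsilon> * (1 - (z - y) ^ k * g z))"
    and \<beta>2: "\<And>z. z \<in> ball y r - {y} \<Longrightarrow> rat_eval \<beta>2 (Some (M z)) = Some (B2 z)"
    and \<epsilon>: "\<epsilon>\<^sup>2 = 1"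
  shows "k \<le> 2"
proof (rule ccontr)
  assume "\<not> k \<le> 2"
  then have k: "k > 2" by simp
  obtain \<rho>' \<phi> where \<rho>': "\<rho>' > 0" and \<phi>': "\<phi> holomorphic_on ball 0 \<rho>'" "inj_on \<phi> (ball 0 \<rho>')"
    and \<phi>ball': "\<And>w. w \<in> ball 0 \<rho>' \<Longrightarrow> \<phi> w \<in> ball y r"
    and \<phi>k': "\<And>w. w \<in> ball 0 \<rho>' \<Longrightarrow> (\<phi> w - y) ^ k * g (\<phi> w) = w ^ k"
    using local_power_chart[OF g(1) r g(2), of k] k by auto
  \<comment> \<open>A radius at most 1 keeps \<open>1 - t ^ k\<close> between 0 and 1 along the
    rays.\<close>
  define \<rho> where "\<rho> = min \<rho>' 1"
  have \<rho>: "\<rho> > 0" "\<rho> \<le> 1" "ball 0 \<rho> \<subseteq> ball (0::complex) \<rho>'" using \<rho>' by (auto simp: \<rho>_def)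
  have \<phi>: "\<phi> holomorphic_on ball 0 \<rho>" "inj_on \<phi> (ball 0 \<rho>)"
    using \<phi>' \<rho>(3) holomorphic_on_subset inj_on_subset by blast+
  have \<phi>k: "(\<phi> w - y) ^ k * g (\<phi> w) = w ^ k" if "w \<in> ball 0 \<rho>" for w
    using \<phi>k' \<rho>(3) that by blast
  define U where "U = ball (0::complex) \<rho> - {0}"
  have \<phi>U: "\<phi> w \<in> ball y r - {y}" if "w \<in> U" for w
  proof -
    have "\<phi> w \<noteq> y" using \<phi>k[of w] that k by (auto simp: U_def power_0_left)
    then show ?thesis using that \<phi>ball' \<rho>(3) by (auto simp: U_def)
  qed
  define X where "X = (\<lambda>w. M (\<phi> w))"
  have injX: "inj_on X U"
  proof (rule inj_onI)
    fix a b assume "a \<in> U" "b \<in> U" "X a = X b"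
    then have "\<phi> a = \<phi> b" using inj_onD[OF M _ \<phi>U \<phi>U] by (simp add: X_def)
    then show "a = b" using inj_onD[OF \<phi>(2)] \<open>a \<in> U\<close> \<open>b \<in> U\<close> by (simp add: U_def)
  qed
  have e1: "rat_eval \<beta>1 (Some (X w)) = Some (\<epsilon> * (1 - w ^ k))" if "w \<in> U" for w
    using \<beta>1[OF \<phi>U[OF that]] \<phi>k[of w] that by (simp add: X_def U_def)
  define H where "H = (\<lambda>w. B2 (\<phi> w))"
  have e2: "rat_eval \<beta>2 (Some (X w)) = Some (H w)" if "w \<in> U" for w
    using \<beta>2[OF \<phi>U[OF that]] by (simp add: X_def H_def)
  have H: "H holomorphic_on ball 0 \<rho>"
    unfolding H_def using \<phi>ball' \<rho>(3)
    by (intro holomorphic_on_compose_gen[OF \<phi>(1) B2, unfolded o_def]) auto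
  define \<omega> where "\<omega> = exp (2 * pi * \<i> / of_nat k)"
  have n\<omega>: "cmod \<omega> = 1" unfolding \<omega>_def norm_exp_eq_Re by simp
  have \<omega>k: "\<omega> ^ k = 1" using k by (simp add: \<omega>_def flip: exp_of_nat_mult)
  obtain \<epsilon>' :: real where \<epsilon>': "\<epsilon> = of_real \<epsilon>'" "\<epsilon>' = 1 \<or> \<epsilon>' = -1"
    using \<epsilon> by (metis power2_eq_1_iff of_real_1 of_real_minus)
  \<comment> \<open>On the ray through a \<open>k\<close>-th root of unity \<open>\<beta>1\<close>
    has values in [-1,1]. The ray thus lies in the common support, where \<open>\<beta>2\<close> is
    real.\<close>
  have real: "H (\<zeta> * of_real t) \<in> \<real>" if \<zeta>: "\<zeta> ^ k = 1" "cmod \<zeta> = 1" and t: "0 < t" "t < \<rho>" for \<zeta> t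
  proof -
    have U: "\<zeta> * of_real t \<in> U" using \<zeta> t by (auto simp: U_def norm_mult)
    define s where "s = \<epsilon>' * (1 - t ^ k)"
    have "0 \<le> t ^ k" "t ^ k \<le> 1" using t \<rho> by (auto intro: power_le_one)
    then have "-1 \<le> s" "s \<le> 1" using \<epsilon>' by (auto simp: s_def)
    moreover have "\<epsilon> * (1 - (\<zeta> * of_real t) ^ k) = of_real s"
      using \<zeta> \<epsilon>' by (simp add: power_mult_distrib s_def)
    ultimately have "Some (X (\<zeta> * of_real t)) \<in> dessin_support \<beta>1"
      using e1[OF U] by (auto simp: dessin_support_def intro!: exI[of _ s])
    then have "Some (X (\<zeta> * of_real t)) \<in> dessin_support \<beta>2" using supp by simp
    then show ?thesis using e2[OF U] by (auto simp: dessin_support_def)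
  qed
  have rot: "H (\<omega>\<^sup>2 * w) = H w" if "w \<in> U" for w
    using that real[of 1] real[OF \<omega>k n\<omega>]
    by (intro rotation_invariant[OF H n\<omega>]) (auto simp: U_def)
  have rotU: "\<omega>\<^sup>2 * w \<in> U" if "w \<in> U" for w
    using that n\<omega> by (auto simp: U_def norm_mult norm_power)
  \<comment> \<open>Each point is paired with its rotated copy; neither function separates the two,
    so \<open>z\<close> itself should not either.\<close>
  define D where "D = (\<lambda>w. (X w, X (\<omega>\<^sup>2 * w))) ` U"
  have "(\<omega>\<^sup>2 * w) ^ k = w ^ k" for w
    by (metis \<omega>k mult_1 power_commutes power_mult power_mult_distrib power_one mult.commute)
  then have agree: "rat_eval \<beta>1 (Some u) = rat_eval \<beta>1 (Some v) \<and> rat_eval \<beta>1 (Some u) \<noteq> None"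
    "rat_eval \<beta>2 (Some u) = rat_eval \<beta>2 (Some v) \<and> rat_eval \<beta>2 (Some u) \<noteq> None"
    if "(u, v) \<in> D" for u v
    using that e1 e2 rot rotU unfolding D_def by auto
  have "\<exists>p q. q \<noteq> 0 \<and> zvar = Fract p q \<and> (\<forall>u v. (u, v) \<in> D \<longrightarrow> poly p u * poly q v = poly p v * poly q u)"
    by (rule gen_field_agree[OF _ agree]) (simp add: gen)
  then obtain p q where pq: "q \<noteq> 0" "zvar = Fract p q"
    and inv: "\<forall>u v. (u, v) \<in> D \<longrightarrow> poly p u * poly q v = poly p v * poly q u"
    by (elim exE conjE)
  have "Fract [:0, 1:] 1 = Fract p q" using pq(2) unfolding zvar_def .
  then have "p = [:0, 1:] * q"
    using pq(1) by (simp add: eq_fract)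
  then have px: "poly p x = x * poly q x" for x by simp
  \<comment> \<open>The relation for \<open>z\<close> only gives equal points where \<open>q\<close>
    is nonzero at both, so the finitely many other \<open>w\<close> are discarded.\<close>
  have fin: "finite {w \<in> U. poly q (X w) = 0}"
  proof (rule finite_imageD)
    show "finite (X ` {w \<in> U. poly q (X w) = 0})"
      by (rule finite_subset[OF _ poly_roots_finite[OF pq(1)]]) auto
    show "inj_on X {w \<in> U. poly q (X w) = 0}" using injX by (rule inj_on_subset) auto
  qed
  have "finite {w \<in> U. poly q (X (\<omega>\<^sup>2 * w)) = 0}"
  proof (rule finite_imageD)
    show "finite ((\<lambda>w. \<omega>\<^sup>2 * w) ` {w \<in> U. poly q (X (\<omega>\<^sup>2 * w)) = 0})"
      by (rule finite_subset[OF _ fin]) (use rotU in auto)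
    show "inj_on (\<lambda>w. \<omega>\<^sup>2 * w) {w \<in> U. poly q (X (\<omega>\<^sup>2 * w)) = 0}"
      by (rule inj_onI) (use n\<omega> in auto)
  qed
  then have "finite ({w \<in> U. poly q (X w) = 0} \<union> {w \<in> U. poly q (X (\<omega>\<^sup>2 * w)) = 0})"
    using fin by simp
  moreover have "infinite U"
  proof -
    have "infinite (ball (0::complex) \<rho>)" using uncountable_ball[OF \<rho>(1), of 0] by (auto dest: countable_finite)
    then show ?thesis by (simp add: U_def)
  qed
  ultimately have "\<not> U \<subseteq> {w \<in> U. poly q (X w) = 0} \<union> {w \<in> U. poly q (X (\<omega>\<^sup>2 * w)) = 0}"
    by (metis finite_subset)
  then obtain w where w: "w \<in> U" "poly q (X w) \<noteq> 0" "poly q (X (\<omega>\<^sup>2 * w)) \<noteq> 0" by auto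
  have "X w = X (\<omega>\<^sup>2 * w)"
    using inv[rule_format, of "X w" "X (\<omega>\<^sup>2 * w)"] w by (auto simp: D_def px)
  then have "w = \<omega>\<^sup>2 * w" using injX w(1) rotU by (auto dest: inj_onD)
  then have "\<omega>\<^sup>2 = 1" using w(1) by (simp add: U_def)
  \<comment> \<open>The angle \<open>4 * pi / k\<close> is then a multiple of a full turn, so
    \<open>k\<close> divides 2.\<close>
  then have "exp (2 * (2 * pi * \<i> / of_nat k)) = 1" by (simp only: \<omega>_def exp_double)
  then obtain n :: int where "4 * pi / k = of_int (2 * n) * pi" by (auto simp: exp_eq_1)
  then have "pi * (4 / real k) = pi * of_int (2 * n)" by (simp add: mult.commute)
  then have "4 / real k = of_int (2 * n)" by (metis mult_left_cancel pi_neq_zero)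
  then have "2 = of_int n * real k" using k by (simp add: field_simps)
  then have "2 = n * int k" by (metis of_int_eq_iff of_int_mult of_int_numeral of_int_of_nat_eq)
  then have "int k dvd 2" by (metis dvd_triv_right)
  then show False using k zdvd_imp_le by fastforce
qed

section \<open>Moving a pole to infinity\<close>

text \<open>The polynomial \<open>w ^ n * p (a + 1 / w)\<close>, for \<open>n \<ge> degree p\<close>.\<close>

definition inversion_poly :: "nat \<Rightarrow> complex \<Rightarrow> complex poly \<Rightarrow> complex poly" where
  "inversion_poly n a p = monom 1 (n - degree p) * reflect_poly (p \<circ>\<^sub>p [:a, 1:])"

lemma poly_inversion_poly:
  assumes "degree p \<le> n" and "w \<noteq> 0"
  shows "poly (inversion_poly n a p) w = w ^ n * poly p (a + 1 / w)"
proof -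
  have "poly (inversion_poly n a p) w = w ^ (n - degree p) * w ^ degree p * poly p (a + 1 / w)"
    using assms by (simp add: inversion_poly_def poly_monom poly_reflect_poly_nz poly_pcompose inverse_eq_divide degree_pcompose)
  then show ?thesis using assms(1) by (simp flip: power_add)
qed

lemma poly_inversion_poly_0:
  assumes "degree p \<le> n"
  shows "poly (inversion_poly n a p) 0 = coeff p n"
proof (cases "degree p = n")
  case True
  have "lead_coeff (p \<circ>\<^sub>p [:a, 1:]) = lead_coeff p" by (subst lead_coeff_comp) auto
  then show ?thesis using True by (simp add: inversion_poly_def poly_monom del: degree_pcompose)
next
  case False
  then show ?thesis using assms by (simp add: inversion_poly_def poly_monom coeff_eq_0)
qed

text \<open>The defining formula depends on the degree of each polynomial, which may drop in the
  difference; the values at all points do not show this dependence.\<close>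

lemma inversion_poly_diff:
  assumes "degree p \<le> n" and "degree q \<le> n"
  shows "inversion_poly n a (p - smult c q) = inversion_poly n a p - smult c (inversion_poly n a q)"
proof -
  have "degree (p - smult c q) \<le> n"
    using assms by (intro degree_diff_le) (auto intro: order.trans[OF degree_smult_le])
  then have "poly (inversion_poly n a (p - smult c q)) w = poly (inversion_poly n a p - smult c (inversion_poly n a q)) w" for w
    using assms by (cases "w = 0") (simp_all add: poly_inversion_poly poly_inversion_poly_0 algebra_simps)
  then show ?thesis by (simp flip: poly_eq_poly_eq_iff add: fun_eq_iff)
qed

lemma pcompose_shift_nz: "p \<noteq> 0 \<Longrightarrow> p \<circ>\<^sub>p [:a, 1:] \<noteq> (0 :: complex poly)"
  by (subst pcompose_eq_0_iff) auto

text \<open>The reflected polynomial has a nonzero constant term, so only the padding monomial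
  vanishes at 0.\<close>

lemma order_inversion_poly_0:
  assumes "p \<noteq> 0"
  shows "order 0 (inversion_poly n a p) = n - degree p"
proof -
  have r: "reflect_poly (p \<circ>\<^sub>p [:a, 1:]) \<noteq> 0" using pcompose_shift_nz[OF assms] by simp
  have "order 0 (reflect_poly (p \<circ>\<^sub>p [:a, 1:])) = 0"
    using pcompose_shift_nz[OF assms, of a] by (intro order_0I) simp
  then show ?thesis
    unfolding inversion_poly_def using r by (subst order_mult) (auto simp: monom_eq_0_iff)
qed

text \<open>Shifting and reflecting are multiplicative and turn the linear factor at
  \<open>a + 1 / w\<close> into a multiple of the one at \<open>w\<close>.\<close>

lemma order_inversion_poly:
  assumes "p \<noteq> 0" and "w \<noteq> 0"
  shows "order w (inversion_poly n a p) = order (a + 1 / w) p"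
proof -
  define b k where "b = a + 1 / w" and "k = order b p"
  obtain s where s: "p = [:-b, 1:] ^ k * s" "\<not> [:-b, 1:] dvd s"
    using order_decomp[OF assms(1), of b] unfolding k_def by blast
  have sb: "poly s b \<noteq> 0" using s(2) by (simp add: poly_eq_0_iff_dvd)
  have lin: "reflect_poly ([:-b, 1:] \<circ>\<^sub>p [:a, 1:]) = smult (- 1 / w) [:-w, 1:]"
  proof -
    have "[:-b, 1:] \<circ>\<^sub>p [:a, 1:] = [:- 1 / w, 1:]" by (simp add: pcompose_pCons b_def)
    moreover have "reflect_poly [:- 1 / w, 1:] = [:1, - 1 / w:]"
      using assms(2) by (subst reflect_poly_pCons) simp_all
    ultimately show ?thesis using assms(2) by simp
  qed
  have pow: "q ^ k \<circ>\<^sub>p [:a, 1:] = (q \<circ>\<^sub>p [:a, 1:]) ^ k" for q :: "complex poly"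
    by (induction k) (simp_all add: pcompose_1 pcompose_mult)
  have "reflect_poly (p \<circ>\<^sub>p [:a, 1:]) =
      reflect_poly ([:-b, 1:] \<circ>\<^sub>p [:a, 1:]) ^ k * reflect_poly (s \<circ>\<^sub>p [:a, 1:])"
    unfolding s(1) by (simp only: pcompose_mult pow reflect_poly_mult reflect_poly_power)
  also have "\<dots> = smult ((- 1 / w) ^ k) ([:-w, 1:] ^ k * reflect_poly (s \<circ>\<^sub>p [:a, 1:]))"
    unfolding lin smult_power mult_smult_left ..
  finally have eq: "reflect_poly (p \<circ>\<^sub>p [:a, 1:]) =
      smult ((- 1 / w) ^ k) ([:-w, 1:] ^ k * reflect_poly (s \<circ>\<^sub>p [:a, 1:]))" .
  have "poly (reflect_poly (s \<circ>\<^sub>p [:a, 1:])) w \<noteq> 0"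
    using sb assms(2) by (simp add: poly_reflect_poly_nz poly_pcompose b_def inverse_eq_divide)
  then have "order w (reflect_poly (s \<circ>\<^sub>p [:a, 1:])) = 0" "reflect_poly (s \<circ>\<^sub>p [:a, 1:]) \<noteq> 0"
    by (auto intro: order_0I simp del: reflect_poly_eq_0_iff)
  then have "order w ([:-w, 1:] ^ k * reflect_poly (s \<circ>\<^sub>p [:a, 1:])) = k"
    by (subst order_mult) (auto simp: order_power_n_n)
  then have "order w (reflect_poly (p \<circ>\<^sub>p [:a, 1:])) = k"
    unfolding eq using assms(2) by (subst order_smult) auto
  moreover have "reflect_poly (p \<circ>\<^sub>p [:a, 1:]) \<noteq> 0" using pcompose_shift_nz[OF assms(1)] by simp
  moreover have "order w (monom 1 (n - degree p)) = 0"
    using assms(2) by (intro order_0I) (simp add: poly_monom)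
  ultimately show ?thesis
    unfolding inversion_poly_def by (subst order_mult) (auto simp: monom_eq_0_iff k_def b_def)
qed

text \<open>Reflection loses degree exactly when the shifted polynomial has constant term
  \<open>poly p a = 0\<close>. At a finite pole this puts the denominator below the
  numerator.\<close>

lemma degree_inversion_poly:
  assumes "p \<noteq> 0" and "degree p \<le> n"
  shows "poly p a \<noteq> 0 \<Longrightarrow> degree (inversion_poly n a p) = n"
    and "poly p a = 0 \<Longrightarrow> degree (inversion_poly n a p) < n"
proof -
  let ?q = "p \<circ>\<^sub>p [:a, 1:]"
  have q0: "?q \<noteq> 0" using pcompose_shift_nz[OF assms(1)] .
  have dq: "degree ?q = degree p" by (simp add: degree_pcompose)
  have c0: "coeff ?q 0 = poly p a" by simp
  have d: "degree (inversion_poly n a p) = n - degree p + degree (reflect_poly ?q)"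
    unfolding inversion_poly_def using q0 by (subst degree_mult_eq) (auto simp: monom_eq_0_iff degree_monom_eq)
  show "degree (inversion_poly n a p) = n" if "poly p a \<noteq> 0"
    using d that c0 assms(2) by (metis degree_reflect_poly_eq dq le_add_diff_inverse2)
  show "degree (inversion_poly n a p) < n" if pa: "poly p a = 0"
  proof -
    obtain c q' where q': "?q = pCons c q'" by (rule pCons_cases)
    then have q'': "?q = pCons 0 q'" using c0 pa by simp
    then have "q' \<noteq> 0" using q0 by auto
    have "degree (reflect_poly ?q) = degree (reflect_poly q')"
      unfolding q'' using \<open>q' \<noteq> 0\<close> by (simp add: reflect_poly_pCons')
    also have "\<dots> \<le> degree q'" by (rule degree_reflect_poly_le)
    also have "\<dots> < degree p" using dq \<open>q' \<noteq> 0\<close> unfolding q'' by simp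
    finally show ?thesis using d assms(2) by simp
  qed
qed

section \<open>Coordinates on the sphere and their topology\<close>

lemma inj_sphere_embed: "inj sphere_embed"
proof (rule injI)
  fix x y assume eq: "sphere_embed x = sphere_embed y"
  have pos: "(cmod z)\<^sup>2 + 1 > 0" for z using zero_le_power2[of "cmod z"] by linarith
  then have nz: "(cmod z)\<^sup>2 + 1 \<noteq> 0" for z by (metis less_irrefl)
  \<comment> \<open>In this form the third coordinate determines the modulus and visibly differs
    from 1, its value at infinity.\<close>
  have third: "((cmod z)\<^sup>2 - 1) / ((cmod z)\<^sup>2 + 1) = 1 - 2 / ((cmod z)\<^sup>2 + 1)" for z
    using nz[of z] by (simp add: field_simps)
  show "x = y"
  proof (cases x; cases y)
    fix z w assume xy: "x = Some z" "y = Some w"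
    have "2 / ((cmod z)\<^sup>2 + 1) = 2 / ((cmod w)\<^sup>2 + 1)"
      using eq by (simp add: xy sphere_embed_def third)
    then have "(cmod z)\<^sup>2 + 1 = (cmod w)\<^sup>2 + 1" using nz[of z] nz[of w] by (simp add: field_simps)
    then show ?thesis using eq nz[of w] by (simp add: xy sphere_embed_def complex_eq_iff)
  qed (use eq nz in \<open>auto simp: sphere_embed_def third\<close>)
qed

lemma continuous_sphere_embed_Some: "continuous_on UNIV (\<lambda>z. sphere_embed (Some z))"
proof -
  have "(cmod z)\<^sup>2 + 1 \<noteq> 0" for z using zero_le_power2[of "cmod z"] by linarith
  then show ?thesis unfolding sphere_embed_def option.case by (intro continuous_intros) auto
qed

text \<open>The inverse of the coordinate \<open>1 / (z - a)\<close>: infinity sits at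
  \<open>w = 0\<close>, and \<open>Some a\<close> is the only point left out.\<close>

definition inv_pt :: "complex \<Rightarrow> complex \<Rightarrow> complex option" where
  "inv_pt a w = (if w = 0 then None else Some (a + 1 / w))"

lemma inj_inv_pt: "inj (inv_pt a)"
  by (rule injI) (auto simp: inv_pt_def split: if_splits)

text \<open>Multiplying through by \<open>(cmod w)\<^sup>2\<close> gives the embedding in the
  homogeneous coordinates \<open>a * w + 1\<close> and \<open>w\<close>, which never vanish
  together, so the formula is also valid at \<open>w = 0\<close>.\<close>

lemma continuous_sphere_embed_inv_pt: "continuous_on UNIV (\<lambda>w. sphere_embed (inv_pt a w))"
proof -
  define N where "N = (\<lambda>w. (cmod (a * w + 1))\<^sup>2 + (cmod w)\<^sup>2)"
  have N0: "N w \<noteq> 0" for w by (cases "w = 0") (auto simp: N_def sum_power2_eq_zero_iff)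
  have eq: "sphere_embed (inv_pt a w) = (2 * Re ((a * w + 1) * cnj w) / N w, 2 * Im ((a * w + 1) * cnj w) / N w,
      ((cmod (a * w + 1))\<^sup>2 - (cmod w)\<^sup>2) / N w)" for w
  proof (cases "w = 0")
    case True
    then show ?thesis by (simp add: inv_pt_def sphere_embed_def N_def)
  next
    case False
    define z where "z = a + 1 / w"
    have aw: "a * w + 1 = z * w" using False by (simp add: z_def distrib_right)
    define r where "r = (cmod w)\<^sup>2"
    define t where "t = (cmod z)\<^sup>2 + 1"
    have "r \<noteq> 0" using False by (simp add: r_def)
    have zw: "(a * w + 1) * cnj w = z * of_real r"
      unfolding aw r_def complex_norm_square by (rule mult.assoc)
    have sq: "(cmod (a * w + 1))\<^sup>2 = (t - 1) * r"
      by (simp add: aw norm_mult power_mult_distrib t_def r_def)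
    have N: "N w = t * r"
      unfolding N_def sq by (simp add: r_def algebra_simps)
    have "sphere_embed (inv_pt a w) = (2 * Re z / t, 2 * Im z / t, (t - 2) / t)"
      using False by (simp add: inv_pt_def sphere_embed_def t_def flip: z_def)
    also have "\<dots> = (2 * (Re z * r) / (t * r), 2 * (Im z * r) / (t * r), (t - 2) * r / (t * r))"
      using \<open>r \<noteq> 0\<close> by simp
    finally show ?thesis
      unfolding N zw sq r_def[symmetric] by (simp add: left_diff_distrib)
  qed
  have "continuous_on UNIV N" unfolding N_def by (intro continuous_intros)
  then have "continuous_on UNIV (\<lambda>w. (2 * Re ((a * w + 1) * cnj w) / N w, 2 * Im ((a * w + 1) * cnj w) / N w,
      ((cmod (a * w + 1))\<^sup>2 - (cmod w)\<^sup>2) / N w))"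
    using N0 by (intro continuous_intros) blast+
  then show ?thesis by (simp only: eq)
qed

lemma homeomorphic_parametrised:
  assumes "continuous_on UNIV (\<lambda>w. sphere_embed (pt w))" and "inj pt"
    and "compact K" and "continuous_on K \<phi>" and "inj_on \<phi> K"
  shows "(sphere_embed ` pt ` \<phi> ` K) homeomorphic K"
proof -
  have "K homeomorphic (sphere_embed ` pt ` \<phi> ` K)"
  proof (rule homeomorphic_compact[OF assms(3)])
    show "continuous_on K (\<lambda>x. sphere_embed (pt (\<phi> x)))"
      by (rule continuous_on_compose2[OF assms(1,4)]) auto
    show "(\<lambda>x. sphere_embed (pt (\<phi> x))) ` K = sphere_embed ` pt ` \<phi> ` K" by (simp add: image_image)
    show "inj_on (\<lambda>x. sphere_embed (pt (\<phi> x))) K"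
      using assms(2,5) inj_sphere_embed by (auto simp: inj_on_def)
  qed
  then show ?thesis by (rule homeomorphic_sym[THEN iffD1])
qed

text \<open>Here \<open>pt\<close> is a coordinate on the sphere in which infinity is a pole of \<open>\<beta>1\<close>.\<close>

lemma support_in_chart:
  assumes "belyi \<beta>1" and supp_eq: "dessin_support \<beta>1 = dessin_support \<beta>2"
    and gen: "gen_field \<beta>1 \<beta>2 = UNIV"
    and pt: "inj pt" "continuous_on UNIV (\<lambda>w. sphere_embed (pt w))"
    and missing: "\<And>x. x \<notin> range pt \<Longrightarrow> rat_eval \<beta>1 x = None"
    and ev1: "\<And>w. rat_eval \<beta>1 (pt w) = (if poly Q w = 0 then None else Some (poly P w / poly Q w))"
    and ev2: "\<And>w. rat_eval \<beta>2 (pt w) = (if poly Q' w = 0 then None else Some (poly P' w / poly Q' w))"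
    and ram1: "\<And>w. poly Q w \<noteq> 0 \<Longrightarrow> ram_index \<beta>1 (pt w) = order w (P - smult (poly P w / poly Q w) Q)"
    and nz: "Q \<noteq> 0" and cop: "\<And>x. poly P x = 0 \<Longrightarrow> poly Q x \<noteq> 0" and deg: "degree Q < degree P"
  shows "is_segment (dessin_support \<beta>1) \<or> is_circle (dessin_support \<beta>1)"
proof -
  \<comment> \<open>Away from \<plusminus>1 the bound is the Belyi condition; over \<plusminus>1 it
    is the bound on the valency of vertices.\<close>
  have ram: "order x (P - smult c Q) \<le> (if c\<^sup>2 = 1 then 2 else 1)"
    if Qx: "poly Q x \<noteq> 0" and Px: "poly P x = c * poly Q x" for x c
  proof -
    have c: "poly P x / poly Q x = c" using Qx Px by simp
    have ev: "rat_eval \<beta>1 (pt x) = Some c" using ev1[of x] Qx c by simp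
    show ?thesis
    proof (cases "c\<^sup>2 = 1")
      case False
      then have "Some c \<notin> {Some (-1), Some 1, None}" by auto
      then have "Some c \<notin> critical_values \<beta>1" using assms(1) unfolding belyi_def by blast
      then have "\<not> critical_point \<beta>1 (pt x)" using ev unfolding critical_values_def by (metis imageI mem_Collect_eq)
      then show ?thesis using ram1[OF Qx] c False by (simp add: critical_point_def)
    next
      case True
      define k where "k = order x (P - smult c Q)"
      have "P - smult c Q \<noteq> 0"
        using deg by (metis degree_smult_le leD right_minus_eq)
      then obtain s where s: "P - smult c Q = [:-x, 1:] ^ k * s" "\<not> [:-x, 1:] dvd s"
        using order_decomp unfolding k_def by blast
      have sx: "poly s x \<noteq> 0" using s(2) by (simp add: poly_eq_0_iff_dvd)
      have "c = 1 \<or> c = -1" using True power2_eq_1_iff by blast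
      then obtain t :: real where "c = of_real t" "-1 \<le> t" "t \<le> 1"
        using that[of 1] that[of "-1"] by auto
      then have "pt x \<in> dessin_support \<beta>1" using ev by (auto simp: dessin_support_def)
      then have "rat_eval \<beta>2 (pt x) \<noteq> None" unfolding supp_eq by (auto simp: dessin_support_def)
      then have Q'x: "poly Q' x \<noteq> 0" using ev2[of x] by auto
      \<comment> \<open>Poles of either function and the coordinate of infinity. Only the latter can
        be \<open>x\<close> itself, hence the punctured ball.\<close>
      define E where "E = {z. poly Q z = 0} \<union> {z. poly Q' z = 0} \<union> {z. pt z = None}"
      have "finite {z. pt z = None}"
      proof (rule finite_imageD)
        show "finite (pt ` {z. pt z = None})" by (rule finite_subset[of _ "{None}"]) auto
        show "inj_on pt {z. pt z = None}" using pt(1) by (rule inj_on_subset) auto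
      qed
      moreover have "Q' \<noteq> 0" using Q'x by auto
      ultimately have "finite E" using nz by (simp add: E_def poly_roots_finite)
      then obtain r where r: "r > 0" "\<And>z. z \<in> E \<Longrightarrow> z \<noteq> x \<Longrightarrow> r \<le> dist x z"
        using finite_set_avoid[of E x] by blast
      have Qz: "poly Q z \<noteq> 0" "poly Q' z \<noteq> 0" if "z \<in> ball x r" for z
        using that r(2)[of z] Qx Q'x by (auto simp: E_def)
      have ptz: "Some (the (pt z)) = pt z" if "z \<in> ball x r - {x}" for z
      proof -
        have "pt z \<noteq> None" using that r(2)[of z] by (auto simp: E_def)
        then show ?thesis by simp
      qed
      \<comment> \<open>Chosen so that \<open>P / Q\<close> takes the form
        \<open>c * (1 - (z - x) ^ k * g z)\<close>, using \<open>c\<^sup>2 = 1\<close>.\<close>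
      define g where "g = (\<lambda>z. - c * poly s z / poly Q z)"
      have "k \<le> 2"
      proof (rule ramification_at_vertex_le_2[OF supp_eq gen r(1)])
        show "g holomorphic_on ball x r" unfolding g_def using Qz by (intro holomorphic_intros) auto
        show "(\<lambda>z. poly P' z / poly Q' z) holomorphic_on ball x r"
          using Qz by (intro holomorphic_intros) auto
        show "g x \<noteq> 0" using sx Qx True by (auto simp: g_def)
        show "inj_on (\<lambda>z. the (pt z)) (ball x r - {x})"
          using ptz pt(1) by (metis (no_types, lifting) inj_onI injD)
        show "rat_eval \<beta>1 (Some (the (pt z))) = Some (c * (1 - (z - x) ^ k * g z))"
          if z: "z \<in> ball x r - {x}" for z
        proof -
          have "poly P z = c * poly Q z + (z - x) ^ k * poly s z"
            using arg_cong[OF s(1), of "\<lambda>p. poly p z"] by (simp add: algebra_simps)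
          then have "poly P z / poly Q z = c + (z - x) ^ k * poly s z / poly Q z"
            using Qz(1)[of z] z by (simp add: add_divide_distrib)
          also have "\<dots> = c * (1 - (z - x) ^ k * g z)"
            using True by (simp add: g_def algebra_simps power2_eq_square)
          finally show ?thesis using z Qz(1)[of z] by (simp add: ptz ev1)
        qed
        show "rat_eval \<beta>2 (Some (the (pt z))) = Some (poly P' z / poly Q' z)" if "z \<in> ball x r - {x}" for z
          using that Qz(2)[of z] by (simp add: ptz ev2)
      qed (rule True)
      then show ?thesis using True by (simp add: k_def)
    qed
  qed
  interpret folded_map P Q using nz cop deg ram by unfold_locales
  have S: "dessin_support \<beta>1 = pt ` supp"
  proof (intro equalityI subsetI)
    fix x assume x: "x \<in> dessin_support \<beta>1"
    then have "rat_eval \<beta>1 x \<noteq> None" by (auto simp: dessin_support_def)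
    then have "x \<in> range pt" by (rule contrapos_np) (rule missing)
    then show "x \<in> pt ` supp" using x by (auto simp: dessin_support_def supp_def ev1 split: if_splits)
  next
    fix x assume "x \<in> pt ` supp"
    then show "x \<in> dessin_support \<beta>1" by (auto simp: dessin_support_def supp_def ev1)
  qed
  show ?thesis
  proof (cases "\<exists>a. poly Q a = 0")
    case True
    then obtain a r where r: "r > 0" "supp = sphere a r" using supp_circle by blast
    have "supp = (\<lambda>u. a + of_real r * u) ` sphere 0 1"
    proof (intro equalityI subsetI)
      fix x assume "x \<in> supp"
      then show "x \<in> (\<lambda>u. a + of_real r * u) ` sphere 0 1"
        using r by (intro image_eqI[of _ _ "(x - a) / of_real r"]) (auto simp: dist_norm norm_divide norm_minus_commute)
    qed (use r in \<open>auto simp: dist_norm norm_mult\<close>)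
    then have "sphere_embed ` dessin_support \<beta>1 homeomorphic sphere (0::complex) 1"
      unfolding S using r
      by (auto intro!: homeomorphic_parametrised pt continuous_intros inj_onI)
    then show ?thesis unfolding is_circle_def by blast
  next
    case False
    obtain m d where d: "d \<noteq> 0" "supp = (\<lambda>t::real. m + d * of_real t) ` {-1..1}"
      by (rule supp_segment) (use False in blast)
    have "supp = (\<lambda>t::real. m + d * of_real (2 * t - 1)) ` {0..1}"
    proof (intro equalityI subsetI)
      fix x assume "x \<in> supp"
      then obtain t :: real where "t \<in> {-1..1}" "x = m + d * of_real t" using d by blast
      then show "x \<in> (\<lambda>t::real. m + d * of_real (2 * t - 1)) ` {0..1}"
        by (intro image_eqI[of _ _ "(t + 1) / 2"]) auto
    next
      fix x assume "x \<in> (\<lambda>t::real. m + d * of_real (2 * t - 1)) ` {0..1}"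
      then obtain t :: real where "t \<in> {0..1}" "x = m + d * of_real (2 * t - 1)" by blast
      then show "x \<in> supp" unfolding d(2) by (intro image_eqI[of _ _ "2 * t - 1"]) auto
    qed
    then have "sphere_embed ` dessin_support \<beta>1 homeomorphic {0..1::real}"
      unfolding S using d(1)
      by (auto intro!: homeomorphic_parametrised pt continuous_intros inj_onI)
    then show ?thesis unfolding is_segment_def by blast
  qed
qed

section \<open>Values and ramification in the inverted coordinate\<close>

lemma num_den_cop: "poly (num f) x = 0 \<Longrightarrow> poly (den f) x \<noteq> 0"
  using num_den(1)[of f] by (metis coprime_poly_0)

lemma rat_eval_Some: "rat_eval f (Some w) =
    (if poly (den f) w = 0 then None else Some (poly (num f) w / poly (den f) w))"
  by (simp add: rat_eval_def Let_def)

definition rdeg :: "ratfun \<Rightarrow> nat" where "rdeg f = max (degree (num f)) (degree (den f))"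

lemma rdeg_le: "degree (num f) \<le> rdeg f" "degree (den f) \<le> rdeg f"
  by (simp_all add: rdeg_def)

text \<open>At \<open>w = 0\<close> the two polynomials take the coefficients at
  \<open>rdeg f\<close> as values, and that of the denominator vanishes exactly when infinity is a
  pole.\<close>

lemma rat_eval_inv_pt:
  fixes f a
  defines "P \<equiv> inversion_poly (rdeg f) a (num f)" and "Q \<equiv> inversion_poly (rdeg f) a (den f)"
  shows "rat_eval f (inv_pt a w) = (if poly Q w = 0 then None else Some (poly P w / poly Q w))"
proof (cases "w = 0")
  case True
  have "coeff (den f) (rdeg f) = 0 \<longleftrightarrow> degree (num f) > degree (den f)"
    using num_den(2)[of f] by (auto simp: rdeg_def max_def coeff_eq_0)
  then show ?thesis
    using True rdeg_le[of f]
    by (auto simp: P_def Q_def inv_pt_def rat_eval_def Let_def poly_inversion_poly_0 rdeg_def max_def)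
next
  case False
  then show ?thesis
    using rdeg_le[of f] by (simp add: P_def Q_def inv_pt_def rat_eval_Some poly_inversion_poly)
qed

text \<open>At \<open>w = 0\<close> the order is \<open>rdeg f\<close> minus the degree of the
  difference, which is how the index at infinity is defined when infinity is not a pole.\<close>

lemma ram_index_inv_pt:
  fixes f a
  defines "P \<equiv> inversion_poly (rdeg f) a (num f)" and "Q \<equiv> inversion_poly (rdeg f) a (den f)"
  assumes "poly Q w \<noteq> 0" and nc: "\<And>c. num f - smult c (den f) \<noteq> 0"
  shows "ram_index f (inv_pt a w) = order w (P - smult (poly P w / poly Q w) Q)"
proof -
  have eq: "order w (P - smult c Q) = order w (inversion_poly (rdeg f) a (num f - smult c (den f)))" for c
    unfolding P_def Q_def by (simp add: inversion_poly_diff rdeg_le)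
  show ?thesis
  proof (cases "w = 0")
    case True
    have Q0: "coeff (den f) (rdeg f) \<noteq> 0"
      using assms(3) True by (simp add: Q_def poly_inversion_poly_0 rdeg_le)
    then have d: "degree (num f) \<le> degree (den f)" "rdeg f = degree (den f)"
      using coeff_eq_0[of "den f" "rdeg f"] by (auto simp: rdeg_def max_def split: if_splits)
    have "poly P w / poly Q w = coeff (num f) (degree (den f)) / lead_coeff (den f)"
      using True d rdeg_le[of f] by (simp add: P_def Q_def poly_inversion_poly_0)
    then show ?thesis
      unfolding eq using True d nc
      by (simp add: inv_pt_def ram_index_def Let_def order_inversion_poly_0)
  next
    case False
    have "poly (den f) (a + 1 / w) \<noteq> 0" and
      "poly P w / poly Q w = poly (num f) (a + 1 / w) / poly (den f) (a + 1 / w)"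
      using assms(3) False by (auto simp: P_def Q_def poly_inversion_poly rdeg_le)
    then show ?thesis
      unfolding eq using False nc
      by (simp add: inv_pt_def ram_index_def Let_def order_inversion_poly)
  qed
qed

lemma nonconstant_num_den:
  assumes "nonconstant f"
  shows "num f - smult c (den f) \<noteq> 0" and "degree (num f) > 0 \<or> degree (den f) > 0"
proof -
  have *: "num f \<noteq> smult c (den f)" for c
  proof
    assume "num f = smult c (den f)"
    moreover have "Fract (smult c (den f)) (den f) = cst c"
      using num_den(2)[of f] by (simp add: cst_def eq_fract)
    ultimately have "f = cst c" using num_den(3)[of f] by simp
    then show False using assms unfolding nonconstant_def by blast
  qed
  then show "num f - smult c (den f) \<noteq> 0" by simp
  show "degree (num f) > 0 \<or> degree (den f) > 0"
  proof (rule ccontr)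
    assume "\<not> ?thesis"
    then obtain p q where pq: "num f = [:p:]" "den f = [:q:]" by (metis degree_eq_zeroE gr0I)
    then have "q \<noteq> 0" using num_den(2)[of f] by auto
    then show False using *[of "p / q"] pq by simp
  qed
qed

theorem theorem1:
  fixes \<beta>1 \<beta>2 :: ratfun
  assumes "belyi \<beta>1" and "belyi \<beta>2"
    and "dessin_support \<beta>1 = dessin_support \<beta>2"
    and "gen_field \<beta>1 \<beta>2 = UNIV"
  shows "(is_segment (dessin_support \<beta>1) \<and> is_segment (dessin_support \<beta>2)) \<or>
         (is_circle (dessin_support \<beta>1) \<and> is_circle (dessin_support \<beta>2))"
proof -
  have nc: "nonconstant \<beta>1" using assms(1) by (simp add: belyi_def)
  have "is_segment (dessin_support \<beta>1) \<or> is_circle (dessin_support \<beta>1)"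
  \<comment> \<open>If infinity is a pole, the standard coordinate serves; otherwise a finite pole
    \<open>a\<close> is moved to infinity.\<close>
  proof (cases "degree (den \<beta>1) < degree (num \<beta>1)")
    case True
    show ?thesis
    proof (rule support_in_chart[OF assms(1,3,4), where pt = Some and P = "num \<beta>1" and Q = "den \<beta>1"
          and P' = "num \<beta>2" and Q' = "den \<beta>2"])
      show "rat_eval \<beta>1 x = None" if "x \<notin> range Some" for x
        using that True by (cases x) (auto simp: rat_eval_def)
      show "ram_index \<beta>1 (Some w) = order w (num \<beta>1 - smult (poly (num \<beta>1) w / poly (den \<beta>1) w) (den \<beta>1))"
        if "poly (den \<beta>1) w \<noteq> 0" for w
        using that by (simp add: ram_index_def Let_def)
    qed (use True in \<open>simp_all add: rat_eval_Some num_den(2) num_den_cop continuous_sphere_embed_Some\<close>)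
  next
    case False
    then have dn: "degree (den \<beta>1) > 0" using nonconstant_num_den(2)[OF nc] by linarith
    then have "\<not> constant (poly (den \<beta>1))" by (simp add: constant_degree)
    then obtain a where a: "poly (den \<beta>1) a = 0"
      using Fundamental_Theorem_Algebra.fundamental_theorem_of_algebra by blast
    then have na: "poly (num \<beta>1) a \<noteq> 0" using num_den_cop by blast
    then have n0: "num \<beta>1 \<noteq> 0" by auto
    let ?P = "inversion_poly (rdeg \<beta>1) a (num \<beta>1)" and ?Q = "inversion_poly (rdeg \<beta>1) a (den \<beta>1)"
    show ?thesis
    proof (rule support_in_chart[OF assms(1,3,4), where pt = "inv_pt a" and P = ?P and Q = ?Q
          and P' = "inversion_poly (rdeg \<beta>2) a (num \<beta>2)" and Q' = "inversion_poly (rdeg \<beta>2) a (den \<beta>2)"])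
      show "rat_eval \<beta>1 x = None" if "x \<notin> range (inv_pt a)" for x
      proof -
        have "x = Some a"
        proof (cases x)
          case None
          then have "x = inv_pt a 0" by (simp add: inv_pt_def)
          then show ?thesis using that by blast
        next
          case (Some z)
          show ?thesis
          proof (rule ccontr)
            assume "x \<noteq> Some a"
            then have "x = inv_pt a (1 / (z - a))" using Some by (simp add: inv_pt_def)
            then show False using that by blast
          qed
        qed
        then show ?thesis using a by (simp add: rat_eval_Some)
      qed
      show "?Q \<noteq> 0"
        using pcompose_shift_nz[OF num_den(2)] by (simp add: inversion_poly_def monom_eq_0_iff)
      show "degree ?Q < degree ?P"
        using degree_inversion_poly(1)[OF n0 rdeg_le(1) na] degree_inversion_poly(2)[OF num_den(2) rdeg_le(2) a] by simp
      show "poly ?Q x \<noteq> 0" if "poly ?P x = 0" for x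
      proof (cases "x = 0")
        \<comment> \<open>\<open>x = 0\<close> stands for infinity, which is not a pole here, so the
          denominator takes its nonzero leading coefficient.\<close>
        case True
        have "rdeg \<beta>1 = degree (den \<beta>1)" using False by (simp add: rdeg_def max_def)
        then show ?thesis using True num_den(2) rdeg_le by (simp add: poly_inversion_poly_0)
      next
        case False
        then show ?thesis using that num_den_cop by (auto simp: poly_inversion_poly rdeg_le)
      qed
    qed (simp_all add: rat_eval_inv_pt ram_index_inv_pt nonconstant_num_den(1)[OF nc, simplified]
        inj_inv_pt continuous_sphere_embed_inv_pt)
  qed
  then show ?thesis using assms(3) by auto
qed

end
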